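(* A line complex in $\mathbb{CP}^3$ (in general position) is fundamental if and only if it may be regarded as a projection onto a hyperplane of a fundamental line complex in $\mathbb{CP}^4$ (in general position). That is: with $\mathbb{CP}^3$ identified with a hyperplane $H\subset\mathbb{CP}^4$, a line complex $\mathsf{l}:\mathbb{Z}^3\to\{\text{lines in }H\}$ is fundamental if and only if there exist a (generic) central projection $\pi$ of $\mathbb{CP}^4$ onto $H$ and a fundamental line complex $\hat{\mathsf{l}}:\mathbb{Z}^3\to\{\text{lines in }\mathbb{CP}^4\}$ such that $\pi(\hat{\mathsf{l}})=\mathsf{l}$ at every point of $\mathbb{Z}^3$.
   Context: Notation: for a function $f$ on $\mathbb{Z}^3$ the argument is suppressed, and lower indices denote unit shifts: $f=f(n_1,n_2,n_3)$, $f_1=f(n_1+1,n_2,n_3)$, $f_{23}=f(n_1,n_2+1,n_3+1)$, etc. A line complex in $\mathbb{CP}^d$ is a map $\mathsf{l}:\mathbb{Z}^3\to\{\text{lines in }\mathbb{CP}^d\}$. Fundamental line complex in $\mathbb{CP}^3$: a line complex in $\mathbb{CP}^3$ such that any neighbouring lines $\mathsf{l}$ and $\mathsf{l}_l$, $l\in\{1,2,3\}$, intersect and the points of intersection $\mathsf{p}^l=\mathsf{l}\cap\mathsf{l}_l$ enjoy the coplanarity property: for any distinct $l,m,p\in\{1,2,3\}$, the four points $\mathsf{p}^l,\mathsf{p}^l_m,\mathsf{p}^l_{mp},\mathsf{p}^l_p$ are coplanar. (Generically, this is equivalent to the concurrency property: for any distinct $l,m,p$, the four lines connecting the points $\mathsf{p}^l,\mathsf{p}^p,\mathsf{p}^l_p,\mathsf{p}^p_l$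 with their shifted counterparts $\mathsf{p}^l_m,\mathsf{p}^p_m,\mathsf{p}^l_{pm},\mathsf{p}^p_{lm}$, respectively, are concurrent.) Fundamental line complex in $\mathbb{CP}^4$: a line complex in $\mathbb{CP}^4$ such that any neighbouring lines $\mathsf{l}$ and $\mathsf{l}_l$ intersect (no coplanarity condition is imposed). Central projection onto a hyperplane $H$: the projection from a point not in $H$. It is called generic for $\hat{\mathsf{l}}$ if the centre of projection is in general position with respect to the lines of $\hat{\mathsf{l}}$; in particular it lies on no line of $\hat{\mathsf{l}}$ and in no plane spanned by two neighbouring lines. Standing genericity: line complexes are assumed to be in general position subject to the required incidences. In particular, neighbouring lines are distinct; for each elementary cube, the points of intersection on a given line which are attached to different edges are distinct; the four lines $\mathsf{l},\mathsf{l}_l,\mathsf{l}_m,\mathsf{l}_{lm}$ attached to any face span a three-dimensional projective space; and, in $\mathbb{CP}^4$, the two hyperplanes spanned by the lines attached to any two opposite faces of an elementary cube are distinct. *)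

theory Defs
  imports "HOL-Analysis.Analysis"
begin

text \<open>
  Projective subspaces of $CP^d$ are complex linear subspaces of \<^typ>\<open>complex^'n\<close>, with
  \<open>CARD('n) = d + 1\<close>; the projective dimension is the linear dimension minus one. Hence incidence is
  inclusion, the intersection of subspaces is \<open>\<inter>\<close> (with \<open>{0}\<close> as the empty projective subspace),
  and the join is the linear span of the union.
\<close>

definition proj_subspace :: "nat \<Rightarrow> (complex^'n) set \<Rightarrow> bool" where
  "proj_subspace k U \<longleftrightarrow> vec.subspace U \<and> vec.dim U = k + 1"

abbreviation proj_point :: "(complex^'n) set \<Rightarrow> bool" where
  "proj_point \<equiv> proj_subspace 0"

abbreviation proj_line :: "(complex^'n) set \<Rightarrow> bool" where
  "proj_line \<equiv> proj_subspace 1"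

abbreviation proj_plane :: "(complex^'n) set \<Rightarrow> bool" where
  "proj_plane \<equiv> proj_subspace 2"

text \<open>The lattice $Z^3$ is \<^typ>\<open>int^3\<close>; lattice directions are the three elements of the type
  \<^typ>\<open>3\<close>. A lower index \<open>i\<close> on \<open>f\<close> is \<^term>\<open>f (n + axis i 1)\<close>.\<close>

abbreviation unit_shift :: "3 \<Rightarrow> int^3" where
  "unit_shift i \<equiv> axis i 1"

definition line_complex_in :: "(complex^'n) set \<Rightarrow> (int^3 \<Rightarrow> (complex^'n) set) \<Rightarrow> bool" where
  "line_complex_in S L \<longleftrightarrow> (\<forall>n. proj_line (L n) \<and> L n \<subseteq> S)"

text \<open>The point $p^i$ of intersection of a line with its neighbour in direction \<open>i\<close>.\<close>

definition meet_point :: "(int^3 \<Rightarrow> (complex^'n) set) \<Rightarrow> 3 \<Rightarrow> int^3 \<Rightarrow> (complex^'n) set" where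
  "meet_point L i n = L n \<inter> L (n + unit_shift i)"

definition neighbours_intersect :: "(int^3 \<Rightarrow> (complex^'n) set) \<Rightarrow> bool" where
  "neighbours_intersect L \<longleftrightarrow> (\<forall>n i. proj_point (meet_point L i n))"

definition coplanarity_property :: "(int^3 \<Rightarrow> (complex^'n) set) \<Rightarrow> bool" where
  "coplanarity_property L \<longleftrightarrow>
    (\<forall>n l m p. l \<noteq> m \<and> l \<noteq> p \<and> m \<noteq> p \<longrightarrow>
      (\<exists>E. proj_plane E \<and>
           meet_point L l n \<subseteq> E \<and>
           meet_point L l (n + unit_shift m) \<subseteq> E \<and>
           meet_point L l (n + unit_shift m + unit_shift p) \<subseteq> E \<and>
           meet_point L l (n + unit_shift p) \<subseteq> E))"

text \<open>Fundamental line complexes in $CP^3$ and in $CP^4$. The former is stated for any ambient space,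
  since $CP^3$ will be a hyperplane of $CP^4$.\<close>

definition fundamental_CP3 :: "(int^3 \<Rightarrow> (complex^'n) set) \<Rightarrow> bool" where
  "fundamental_CP3 L \<longleftrightarrow> neighbours_intersect L \<and> coplanarity_property L"

definition fundamental_CP4 :: "(int^3 \<Rightarrow> (complex^5) set) \<Rightarrow> bool" where
  "fundamental_CP4 L \<longleftrightarrow> neighbours_intersect L"

definition face_span :: "(int^3 \<Rightarrow> (complex^'n) set) \<Rightarrow> 3 \<Rightarrow> 3 \<Rightarrow> int^3 \<Rightarrow> (complex^'n) set" where
  "face_span L i j n =
    vec.span (L n \<union> L (n + unit_shift i) \<union> L (n + unit_shift j) \<union> L (n + unit_shift i + unit_shift j))"

text \<open>In the second condition, two different edges of an elementary cube which share the vertex \<open>n\<close>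
  have different directions \<open>i\<close>, \<open>j\<close>; the signs \<open>s\<close>, \<open>t\<close> select one of the eight cubes at \<open>n\<close>.\<close>

definition general_position :: "(int^3 \<Rightarrow> (complex^'n) set) \<Rightarrow> bool" where
  "general_position L \<longleftrightarrow>
    (\<forall>n i. L n \<noteq> L (n + unit_shift i)) \<and>
    (\<forall>n i j P Q. \<forall>s\<in>{-1, 1}. \<forall>t\<in>{-1, 1}. i \<noteq> j \<longrightarrow>
       proj_point P \<longrightarrow> P \<subseteq> L n \<inter> L (n + axis i s) \<longrightarrow>
       proj_point Q \<longrightarrow> Q \<subseteq> L n \<inter> L (n + axis j t) \<longrightarrow> P \<noteq> Q) \<and>
    (\<forall>n i j. i \<noteq> j \<longrightarrow> proj_subspace 3 (face_span L i j n))"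

definition general_position_CP4 :: "(int^3 \<Rightarrow> (complex^5) set) \<Rightarrow> bool" where
  "general_position_CP4 L \<longleftrightarrow>
    general_position L \<and>
    (\<forall>n i j k. i \<noteq> j \<and> i \<noteq> k \<and> j \<noteq> k \<longrightarrow>
       face_span L j k n \<noteq> face_span L j k (n + unit_shift i))"

text \<open>Central projection from the point \<open>C\<close> onto the hyperplane \<open>H\<close>: join with \<open>C\<close>, then intersect
  with \<open>H\<close>. For a projective subspace \<open>X\<close> not containing \<open>C\<close> this is the image of \<open>X\<close>.\<close>

definition central_projection ::
  "(complex^'n) set \<Rightarrow> (complex^'n) set \<Rightarrow> (complex^'n) set \<Rightarrow> (complex^'n) set" where
  "central_projection C H X = vec.span (C \<union> X) \<inter> H"

definition generic_centre :: "(complex^'n) set \<Rightarrow> (int^3 \<Rightarrow> (complex^'n) set) \<Rightarrow> bool" where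
  "generic_centre C L \<longleftrightarrow>
    (\<forall>n. \<not> C \<subseteq> L n) \<and>
    (\<forall>n i. \<not> C \<subseteq> vec.span (L n \<union> L (n + unit_shift i)))"

end

theory Submission
  imports Defs
begin

text \<open>
  Fix the centre \<open>c \<notin> H\<close>. A line of $CP^4$ that projects from \<open>c\<close> onto the line \<open>L n\<close> and misses
  \<open>c\<close> is a graph \<open>{v + \<phi> n v c | v \<in> L n}\<close> of a linear form \<open>\<phi> n\<close> on \<open>L n\<close>, so lifting \<open>L\<close> means
  choosing one form per line. Lifts of neighbouring lines intersect exactly if the two forms agree at
  the point of intersection of the lines below, and a face is lifted into the graph of a linear form
  on \<open>H\<close>. The two hyperplanes of opposite faces of a cube are distinct unless a single form on \<open>H\<close>
  restricts to all eight forms of the cube.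

  If \<open>L\<close> is such a projection, the four points \<open>p\<^sup>l, p\<^sup>l\<^sub>m, p\<^sup>l\<^sub>m\<^sub>p, p\<^sup>l\<^sub>p\<close> upstairs lie in the hyperplanes of two
  opposite faces. These hyperplanes are distinct, hence meet in a plane, and the projection of that
  plane contains the four points downstairs (\<open>projection_fundamental\<close>).

  Conversely let \<open>L\<close> be fundamental. In general position the four lines of a face join cyclically
  consecutive members of a basis of \<open>H\<close>, so compatible forms on them have a unique common extension
  \<open>F\<close> to \<open>H\<close>. Take the forms on a cube and suppose that they agree along eleven of its edges. Let the
  twelfth edge have direction \<open>l\<close>; the two faces transversal to \<open>l\<close> carry extensions \<open>F\<close> and \<open>F'\<close>, which
  agree at three of the four points on the edges of direction \<open>l\<close>. Three of these points are never
  collinear, and the fourth lies in their plane, so the forms agree there too. Thus coplanarity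
  closes the last edge of every cube (\<open>cube_closes\<close>).

  Given the forms on one lattice slice, the form on a line of the next slice is determined up to one
  scalar, and agreement along an edge is an affine bijection between the scalars of neighbouring
  lines. That the last edge of a cube closes says that these bijections commute around every square,
  so each initial scalar spreads uniquely over the slice (\<open>flat_section\<close>). Two different initial
  scalars differ everywhere, so each cube between the two slices excludes at most one initial scalar as
  degenerate. There are countably many cubes and uncountably many scalars: some scalar keeps all
  these cubes nondegenerate (\<open>slab_lift\<close>). Starting from the zero form on one slice and proceeding
  slice by slice in both directions yields the lift (\<open>compatible_forms_exist\<close>).
\<close>

section \<open>Linear forms and skew quadrilaterals\<close>

interpretation form: vector_space_pair "(*s) :: complex \<Rightarrow> complex^'n \<Rightarrow> complex^'n" "(*)"
  ..

abbreviation linear_form :: "(complex^'n \<Rightarrow> complex) \<Rightarrow> bool" where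
  "linear_form \<equiv> Vector_Spaces.linear (*s) (*)"

lemma linear_form_add: "linear_form F \<Longrightarrow> F (x + y) = F x + F y"
  and linear_form_diff: "linear_form F \<Longrightarrow> F (x - y) = F x - F y"
  and linear_form_scale: "linear_form F \<Longrightarrow> F (a *s x) = a * F x"
  and linear_form_zero: "linear_form F \<Longrightarrow> F 0 = 0"
  using form.linear_add form.linear_diff form.linear_scale form.linear_0 by blast+

lemma linear_form_combination:
  fixes F G :: "complex^'n \<Rightarrow> complex"
  assumes "linear_form F" "linear_form G"
  shows "linear_form (\<lambda>x. F x + t * G x)"
  using assms by (simp add: Vector_Spaces.linear_iff algebra_simps)

lemma span_pair_iff:
  fixes x p q :: "complex^'n"
  shows "x \<in> vec.span {p, q} \<longleftrightarrow> (\<exists>a b. x = a *s p + b *s q)"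
proof
  assume "x \<in> vec.span {p, q}"
  then obtain a b where "x - a *s p = b *s q"
    by (auto simp: vec.span_insert)
  then show "\<exists>a b. x = a *s p + b *s q"
    by (metis add.commute diff_add_cancel)
next
  assume "\<exists>a b. x = a *s p + b *s q"
  then obtain a b where "x = a *s p + b *s q"
    by blast
  moreover have "a *s p + b *s q \<in> vec.span {p, q}"
    by (intro vec.span_add vec.span_scale vec.span_base) simp_all
  ultimately show "x \<in> vec.span {p, q}"
    by simp
qed

text \<open>
  The lines of a face in general position: the sides \<open>A, B, C, D\<close> of a spatial quadrilateral with
  vertices \<open>p, q, r, s\<close>, where \<open>p\<close> lies on \<open>D\<close> and \<open>A\<close>, \<open>q\<close> on \<open>A\<close> and \<open>B\<close>, and so on. Naming the
  vertices reduces compatibility of forms on the lines to equations at single vectors.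
\<close>

definition skew_quad ::
  "(complex^'n) set \<Rightarrow> (complex^'n) set \<Rightarrow> (complex^'n) set \<Rightarrow> (complex^'n) set \<Rightarrow> (complex^'n) set \<Rightarrow>
   complex^'n \<Rightarrow> complex^'n \<Rightarrow> complex^'n \<Rightarrow> complex^'n \<Rightarrow> bool" where
  "skew_quad H A B C D p q r s \<longleftrightarrow>
     distinct [p, q, r, s] \<and> vec.independent {p, q, r, s} \<and> H = vec.span {p, q, r, s} \<and>
     A = vec.span {p, q} \<and> B = vec.span {q, r} \<and> C = vec.span {r, s} \<and> D = vec.span {s, p}"

lemma skew_quad_rotate: "skew_quad H A B C D p q r s \<Longrightarrow> skew_quad H B C D A q r s p"
  by (auto simp: skew_quad_def insert_commute)

lemma skew_quad_reverse: "skew_quad H A B C D p q r s \<Longrightarrow> skew_quad H D C B A p s r q"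
  by (auto simp: skew_quad_def insert_commute)

text \<open>
  The vertices are a basis of \<open>H\<close>, so forms on the sides that agree at the vertices extend to one
  form on \<open>H\<close>; by the next lemma this extension is unique on \<open>H\<close>.
\<close>

lemma skew_quad_form:
  fixes p q r s :: "complex^'n"
  assumes "skew_quad H A B C D p q r s"
  obtains F where "linear_form F" "F p = a" "F q = b" "F r = c" "F s = d"
proof -
  have "vec.independent {p, q, r, s}" and dist: "distinct [p, q, r, s]"
    using assms by (auto simp: skew_quad_def)
  from form.linear_independent_extend[OF this(1),
      of "\<lambda>x. if x = p then a else if x = q then b else if x = r then c else d"]
  obtain F where F: "linear_form F"
    "\<forall>x\<in>{p,q,r,s}. F x = (if x = p then a else if x = q then b else if x = r then c else d)"
    by blast
  show thesis
    by (rule that[OF F(1)]) (use F(2) dist in auto)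
qed

lemma skew_quad_form_eq:
  fixes p q r s :: "complex^'n"
  assumes "skew_quad H A B C D p q r s" "linear_form F" "linear_form G"
    and "F p = G p" "F q = G q" "F r = G r" "F s = G s" and "x \<in> H"
  shows "F x = G x"
  by (rule form.linear_eq_on_span[of F G "{p,q,r,s}"]) (use assms in \<open>auto simp: skew_quad_def\<close>)

lemma linear_form_eq_pair:
  fixes p q :: "complex^'n"
  assumes "linear_form F" "linear_form G" "F p = G p" "F q = G q" "x \<in> vec.span {p, q}"
  shows "F x = G x"
  by (rule form.linear_eq_on_span[of F G "{p,q}"]) (use assms in auto)

lemma skew_quad_mem:
  assumes "skew_quad H A B C D p q r s"
  shows "p \<in> A" "p \<in> D" "q \<in> A" "q \<in> B" "r \<in> B" "r \<in> C" "s \<in> C" "s \<in> D"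
  using assms by (auto simp: skew_quad_def vec.span_base)

lemma skew_quad_subset:
  assumes "skew_quad H A B C D p q r s"
  shows "A \<subseteq> H" "B \<subseteq> H" "C \<subseteq> H" "D \<subseteq> H"
  using assms by (simp_all add: skew_quad_def vec.span_mono)

lemma skew_quad_not_multiple:
  assumes "skew_quad H A B C D p q r s"
  shows "s \<notin> vec.span {p}" "q \<notin> vec.span {p}"
proof -
  obtain F where "linear_form F" "F p = 0" "F s = 1" "F q = 1"
    using skew_quad_form[OF assms] by metis
  then have "F x = 0" if "x \<in> vec.span {p}" for x
    using that by (auto simp: vec.span_insert linear_form_scale)
  with \<open>F s = 1\<close> \<open>F q = 1\<close> show "s \<notin> vec.span {p}" "q \<notin> vec.span {p}" by auto
qed

section \<open>Closing the last edge of a cube\<close>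

text \<open>
  Notation for a cube: unprimed and primed lines are the two faces transversal to one direction;
  within a face, \<open>A\<close> has the neighbours \<open>Av\<close> and \<open>B\<close>, and \<open>Bv\<close> is opposite to \<open>A\<close>. The points \<open>x, y, z\<close> lie
  on \<open>A, Av, B\<close>. Both \<open>x\<close> and \<open>y\<close> are in the span of \<open>P, xv, P'\<close>, while \<open>z\<close> is a point of the line
  spanned by \<open>yv\<close> and \<open>P\<close> other than \<open>P\<close>; as \<open>P, xv, P', yv\<close> are independent, \<open>z\<close> is not in that span.
\<close>

lemma cube_noncollinear:
  assumes side: "skew_quad H A Av Bv B P xv P' yv"
    and bottom: "skew_quad H A A' Av' Av xv x xv' y"
    and z: "z \<in> B" "z \<notin> vec.span {P}"
  shows "vec.independent {x, y, z}" "card {x, y, z} = 3"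
proof -
  have "x \<notin> vec.span {}" "y \<notin> vec.span {x}"
  proof -
    obtain F where F: "linear_form F" "F x = 0" "F y = 1"
      using skew_quad_form[OF bottom] by metis
    then have "F w = 0" if "w \<in> vec.span {x}" for w
      using that by (auto simp: vec.span_insert linear_form_scale)
    with F show "y \<notin> vec.span {x}" by auto
    obtain F where "linear_form F" "F x = 1"
      using skew_quad_form[OF bottom] by metis
    then show "x \<notin> vec.span {}" by (auto simp: linear_form_zero)
  qed
  moreover have "z \<notin> vec.span {y, x}"
  proof
    assume "z \<in> vec.span {y, x}"
    then obtain a b where zxy: "z = a *s y + b *s x"
      by (auto simp: span_pair_iff)
    obtain F where F: "linear_form F" "F P = 0" "F xv = 0" "F P' = 0" "F yv = 1"
      using skew_quad_form[OF side] by metis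
    have "F w = 0" if "w \<in> vec.span {P, xv} \<union> vec.span {xv, P'}" for w
      using that F by (auto simp: span_pair_iff linear_form_add linear_form_scale)
    moreover have "x \<in> vec.span {P, xv}" "y \<in> vec.span {xv, P'}"
      using side skew_quad_mem[OF bottom] by (auto simp: skew_quad_def)
    ultimately have "F z = 0"
      using F(1) zxy by (simp add: linear_form_add linear_form_scale)
    moreover obtain c d where "z = c *s yv + d *s P"
      using z(1) side by (auto simp: skew_quad_def span_pair_iff)
    ultimately have "z = d *s P"
      using F by (simp add: linear_form_add linear_form_scale)
    with z(2) show False
      by (simp add: vec.span_scale vec.span_base)
  qed
  ultimately have "vec.independent {z, y, x}" and "x \<noteq> y" "z \<noteq> x" "z \<noteq> y"
    by (auto simp: vec.independent_insert intro: vec.span_base)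
  then show "vec.independent {x, y, z}" "card {x, y, z} = 3"
    by (simp_all add: insert_commute)
qed

text \<open>
  The forms are compatible on both faces and along the three edges through \<open>x, y, z\<close>. The
  extensions \<open>F\<close> and \<open>F'\<close> of the two faces therefore agree on the span of \<open>x, y, z\<close>, which is \<open>E\<close> by
  dimension, and \<open>u \<in> E\<close>. This is the only place where coplanarity enters the construction of a lift.
\<close>

lemma cube_closes:
  fixes f f' fv fv' g g' gv gv' :: "complex^'n \<Rightarrow> complex"
  assumes lower: "skew_quad H A Av Bv B P xv P' yv"
    and upper: "skew_quad H A' Av' Bv' B' Q xv' Q' yv'"
    and bottom: "skew_quad H A A' Av' Av xv x xv' y"
    and z: "z \<in> B \<inter> B'" "z \<notin> vec.span {P}"
    and u: "u \<in> Bv \<inter> Bv'"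
    and E: "vec.subspace E" "vec.dim E = 3" "{x, y, z, u} \<subseteq> E"
    and lin: "linear_form f" "linear_form fv" "linear_form g" "linear_form gv"
      "linear_form f'" "linear_form fv'" "linear_form g'" "linear_form gv'"
    and edges: "g P = f P" "f xv = fv xv" "gv P' = fv P'" "g yv = gv yv"
      "g' Q = f' Q" "f' xv' = fv' xv'" "gv' Q' = fv' Q'" "g' yv' = gv' yv'"
    and across: "f x = f' x" "fv y = fv' y" "g z = g' z"
  shows "gv u = gv' u"
proof -
  obtain F where F: "linear_form F" "F P = f P" "F xv = f xv" "F P' = fv P'" "F yv = g yv"
    using skew_quad_form[OF lower] by metis
  obtain F' where F': "linear_form F'" "F' Q = f' Q" "F' xv' = f' xv'" "F' Q' = fv' Q'" "F' yv' = g' yv'"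
    using skew_quad_form[OF upper] by metis
  have lines: "A = vec.span {P, xv}" "Av = vec.span {xv, P'}" "Bv = vec.span {P', yv}" "B = vec.span {yv, P}"
    "A' = vec.span {Q, xv'}" "Av' = vec.span {xv', Q'}" "Bv' = vec.span {Q', yv'}" "B' = vec.span {yv', Q}"
    using lower upper by (auto simp: skew_quad_def)
  have "F x = F' x"
    using skew_quad_mem[OF bottom] F F' across(1) edges
      linear_form_eq_pair[OF F(1) lin(1), of P xv x] linear_form_eq_pair[OF F'(1) lin(5), of Q xv' x]
    by (simp add: lines)
  moreover have "F y = F' y"
    using skew_quad_mem[OF bottom] F F' across(2) edges
      linear_form_eq_pair[OF F(1) lin(2), of xv P' y] linear_form_eq_pair[OF F'(1) lin(6), of xv' Q' y]
    by (simp add: lines)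
  moreover have "F z = F' z"
    using z F F' across(3) edges
      linear_form_eq_pair[OF F(1) lin(3), of yv P z] linear_form_eq_pair[OF F'(1) lin(7), of yv' Q z]
    by (simp add: lines)
  moreover have "u \<in> vec.span {x, y, z}"
    using vec.card_ge_dim_independent[of "{x, y, z}" E] cube_noncollinear[OF lower bottom _ z(2)] z(1) E
    by auto
  ultimately have "F u = F' u"
    using form.linear_eq_on_span[OF F(1) F'(1), of "{x, y, z}" u] by auto
  then show ?thesis
    using u F F' edges
      linear_form_eq_pair[OF F(1) lin(4), of P' yv u] linear_form_eq_pair[OF F'(1) lin(8), of Q' yv' u]
    by (simp add: lines)
qed

section \<open>Flat families of bijections over the square lattice\<close>

lemma int_dependent_choice:
  fixes P :: "int \<Rightarrow> 'a \<Rightarrow> bool" and R :: "int \<Rightarrow> 'a \<Rightarrow> 'a \<Rightarrow> bool"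
  assumes base: "P 0 x0"
    and up: "\<And>k x. P k x \<Longrightarrow> \<exists>y. P (k + 1) y \<and> R k x y"
    and down: "\<And>k y. P (k + 1) y \<Longrightarrow> \<exists>x. P k x \<and> R k x y"
  shows "\<exists>f. f 0 = x0 \<and> (\<forall>k. P k (f k) \<and> R k (f k) (f (k + 1)))"
proof -
  obtain g where g: "g 0 = x0" "\<And>n. P (int n) (g n)" "\<And>n. R (int n) (g n) (g (Suc n))"
  proof -
    have "\<exists>y. (P (int (Suc n)) y \<and> (Suc n = 0 \<longrightarrow> y = x0)) \<and> R (int n) x y"
      if "P (int n) x \<and> (n = 0 \<longrightarrow> x = x0)" for n x
      using that up[of "int n" x] by (simp add: add.commute)
    from dependent_nat_choice[of "\<lambda>n x. P (int n) x \<and> (n = 0 \<longrightarrow> x = x0)"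
        "\<lambda>n x y. R (int n) x y", OF _ this]
    show thesis using that base by auto
  qed
  obtain h where h: "h 0 = x0" "\<And>n. P (- int n) (h n)" "\<And>n. R (- int (Suc n)) (h (Suc n)) (h n)"
  proof -
    have "\<exists>y. (P (- int (Suc n)) y \<and> (Suc n = 0 \<longrightarrow> y = x0)) \<and> R (- int (Suc n)) y x"
      if "P (- int n) x \<and> (n = 0 \<longrightarrow> x = x0)" for n x
      using that down[of "- int (Suc n)" x] by simp
    from dependent_nat_choice[of "\<lambda>n x. P (- int n) x \<and> (n = 0 \<longrightarrow> x = x0)"
        "\<lambda>n x y. R (- int (Suc n)) y x", OF _ this]
    show thesis using that base by auto
  qed
  define f where "f k = (if k \<ge> 0 then g (nat k) else h (nat (- k)))" for k
  have "P k (f k)" for k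
    using g(2)[of "nat k"] h(2)[of "nat (- k)"] by (auto simp: f_def)
  moreover have "R k (f k) (f (k + 1))" for k
  proof (cases "k \<ge> 0")
    case True
    then show ?thesis using g(3)[of "nat k"] by (simp add: f_def nat_add_distrib)
  next
    case False
    then have "nat (- k) = Suc (nat (- 1 - k))" by simp
    moreover have "f (k + 1) = h (nat (- 1 - k))"
      using False g(1) h(1) by (cases "k = - 1") (auto simp: f_def algebra_simps)
    ultimately show ?thesis
      using False h(3)[of "nat (- 1 - k)"] by (simp add: f_def)
  qed
  ultimately show ?thesis using g(1) by (intro exI[of _ f]) (simp add: f_def)
qed

text \<open>
  A discrete flat connection on $Z^2$ has a section through every initial value: transport along the
  horizontal axis first, then vertically; flatness carries the horizontal equations from one row to
  the next.
\<close>

lemma flat_section: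
  fixes h v :: "int \<Rightarrow> int \<Rightarrow> 'a \<Rightarrow> 'a"
  assumes bij: "\<And>a b. bij (h a b)" "\<And>a b. bij (v a b)"
    and flat: "\<And>a b t. v (a + 1) b (h a b t) = h a (b + 1) (v a b t)"
  shows "\<exists>s. s 0 0 = t0 \<and> (\<forall>a b. s (a + 1) b = h a b (s a b) \<and> s a (b + 1) = v a b (s a b))"
proof -
  have line: "\<exists>f. f 0 = t0 \<and> (\<forall>k. f (k + 1) = w k (f k))" if "\<And>k. bij (w k)"
    for w :: "int \<Rightarrow> 'a \<Rightarrow> 'a" and t0
    using int_dependent_choice[of "\<lambda>_ _. True" t0 "\<lambda>k x y. y = w k x"] that
    by (metis bij_pointE)
  obtain r where r: "r 0 = t0" "\<And>a. r (a + 1) = h a 0 (r a)"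
    using line[of "\<lambda>a. h a 0" t0] bij(1) by metis
  have "\<exists>f. f 0 = r a \<and> (\<forall>b. f (b + 1) = v a b (f b))" for a
    using line[of "v a" "r a"] bij(2) by metis
  then obtain s where s: "\<And>a. s a 0 = r a" "\<And>a b. s a (b + 1) = v a b (s a b)"
    by metis
  have "s (a + 1) b = h a b (s a b)" for a b
  proof (induction b rule: int_induct[where k = 0])
    case base
    then show ?case by (simp add: s(1) r(2))
  next
    case (step1 b)
    then show ?case by (simp add: s(2) flat)
  next
    case (step2 b)
    have "v (a + 1) (b - 1) (s (a + 1) (b - 1)) = h a b (s a b)"
      using step2 s(2)[of "a + 1" "b - 1"] by simp
    also have "\<dots> = v (a + 1) (b - 1) (h a (b - 1) (s a (b - 1)))"
      using flat[of a "b - 1"] s(2)[of a "b - 1"] by simp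
    finally show ?case
      using bij(2) by (metis bij_pointE)
  qed
  with s r show ?thesis by (intro exI[of _ s]) auto
qed

text \<open>
  Transport is injective, so the sections with different initial values differ at every lattice
  point, and each condition \<open>s a b \<noteq> u a b\<close> excludes at most one initial value. Countably many
  conditions cannot exhaust an uncountable fibre.
\<close>

lemma flat_section_avoiding:
  fixes h v :: "int \<Rightarrow> int \<Rightarrow> 'a \<Rightarrow> 'a"
  assumes bij: "\<And>a b. bij (h a b)" "\<And>a b. bij (v a b)"
    and flat: "\<And>a b t. v (a + 1) b (h a b t) = h a (b + 1) (v a b t)"
    and unc: "uncountable (UNIV :: 'a set)"
  shows "\<exists>s. (\<forall>a b. s (a + 1) b = h a b (s a b) \<and> s a (b + 1) = v a b (s a b) \<and> s a b \<noteq> u a b)"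
proof -
  obtain s where s: "\<And>t. s t 0 0 = t" "\<And>t a b. s t (a + 1) b = h a b (s t a b)"
      "\<And>t a b. s t a (b + 1) = v a b (s t a b)"
    using flat_section[of h v, OF bij flat] by metis
  have hor: "s t (a + 1) b = s t' (a + 1) b \<longleftrightarrow> s t a b = s t' a b" for t t' a b
    unfolding s using bij by (metis bij_pointE)
  have ver: "s t a (b + 1) = s t' a (b + 1) \<longleftrightarrow> s t a b = s t' a b" for t t' a b
    unfolding s using bij by (metis bij_pointE)
  have "s t a b = s t' a b \<longleftrightarrow> s t a 0 = s t' a 0" for t t' a b
  proof (induction b rule: int_induct[where k = 0])
    case (step2 b)
    then show ?case using ver[of t a "b - 1" t'] by simp
  qed (simp_all add: ver)
  moreover have "s t a 0 = s t' a 0 \<longleftrightarrow> t = t'" for t t' a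
  proof (induction a rule: int_induct[where k = 0])
    case (step2 a)
    then show ?case using hor[of t "a - 1" 0 t'] by simp
  qed (simp_all add: s(1) hor)
  ultimately have inj: "s t a b = s t' a b \<longleftrightarrow> t = t'" for t t' a b
    by simp
  have "countable {t. s t a b = u a b}" for a b
  proof (cases "\<exists>t. s t a b = u a b")
    case True
    then obtain t where "s t a b = u a b" ..
    then have "{t. s t a b = u a b} = {t}"
      by (auto simp: inj dest: sym)
    then show ?thesis by simp
  qed simp
  then have "countable (\<Union>(a, b). {t. s t a b = u a b})"
    by (intro countable_UN) auto
  with unc have "(\<Union>(a, b). {t. s t a b = u a b}) \<noteq> UNIV"
    by auto
  then obtain t where "\<And>a b. s t a b \<noteq> u a b"
    by auto
  then show ?thesis using s(2,3) by (intro exI[of _ "s t"]) auto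
qed

section \<open>Compatible forms on the whole lattice\<close>

lemma skew_quad_form_nonzero:
  fixes G :: "complex^'n \<Rightarrow> complex"
  assumes "skew_quad H A B C D p q r s" "linear_form G" "G p = 0" "G s = 1" "x \<in> D" "x \<notin> vec.span {p}"
  shows "G x \<noteq> 0"
proof
  assume "G x = 0"
  obtain a b where x: "x = a *s s + b *s p"
    using assms(1,5) by (auto simp: skew_quad_def span_pair_iff)
  with assms \<open>G x = 0\<close> have "x = b *s p"
    by (simp add: linear_form_add linear_form_scale)
  with assms(6) show False
    by (simp add: vec.span_scale vec.span_base)
qed

lemma bij_affine:
  fixes c :: complex
  assumes "c \<noteq> 0" "d \<noteq> 0"
  shows "bij (\<lambda>t. (a + t * c - b) / d)"
  by (rule o_bij[of "\<lambda>s. (s * d + b - a) / c"]) (use assms in \<open>auto simp: fun_eq_iff field_simps\<close>)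

text \<open>
  The step from a slice \<open>A\<close> with compatible forms \<open>f\<close> to an adjacent slice \<open>B\<close>. The vectors \<open>xh, xv\<close> and
  \<open>yh, yv\<close> span the intersections of neighbouring lines within \<open>A\<close> and within \<open>B\<close>, and \<open>P\<close> those between the
  slices. Nothing distinguishes above from below, so the lemma extends the forms in either direction. The last
  conclusion is nondegeneracy: no form extends \<open>f\<close> on the \<open>A\<close>-face of a cube and also the new form
  at one further point of the cube.
\<close>

lemma slab_lift:
  fixes A B :: "int \<Rightarrow> int \<Rightarrow> (complex^'n) set" and P xh xv yh yv :: "int \<Rightarrow> int \<Rightarrow> complex^'n"
    and f :: "int \<Rightarrow> int \<Rightarrow> complex^'n \<Rightarrow> complex"
  assumes hor: "\<And>a b. skew_quad H (A a b) (A (a + 1) b) (B (a + 1) b) (B a b)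
      (P a b) (xh a b) (P (a + 1) b) (yh a b)"
    and ver: "\<And>a b. skew_quad H (A a b) (A a (b + 1)) (B a (b + 1)) (B a b)
      (P a b) (xv a b) (P a (b + 1)) (yv a b)"
    and bottom: "\<And>a b. skew_quad H (A a b) (A (a + 1) b) (A (a + 1) (b + 1)) (A a (b + 1))
      (xv a b) (xh a b) (xv (a + 1) b) (xh a (b + 1))"
    and coplanar: "\<And>a b. \<exists>E. vec.subspace E \<and> vec.dim E = 3 \<and>
      {xh a b, xh a (b + 1), yh a b, yh a (b + 1)} \<subseteq> E"
    and f: "\<And>a b. linear_form (f a b)"
      "\<And>a b. f a b (xh a b) = f (a + 1) b (xh a b)" "\<And>a b. f a b (xv a b) = f a (b + 1) (xv a b)"
  shows "\<exists>g. (\<forall>a b. linear_form (g a b) \<and> g a b (P a b) = f a b (P a b) \<and>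
        g a b (yh a b) = g (a + 1) b (yh a b) \<and> g a b (yv a b) = g a (b + 1) (yv a b)) \<and>
      (\<forall>a b F. linear_form F \<longrightarrow>
        (\<forall>a'\<in>{a, a + 1}. \<forall>b'\<in>{b, b + 1}. \<forall>x\<in>A a' b'. F x = f a' b' x) \<longrightarrow>
        F (yh a b) \<noteq> g a b (yh a b))"
proof -
  \<comment> \<open>The admissible forms on \<open>B a b\<close> are \<open>G0 + t G1\<close>; their parameter \<open>t\<close> is the value at \<open>yh a b\<close>.\<close>
  have "\<exists>G. linear_form G \<and> G (P a b) = f a b (P a b) \<and> G (yh a b) = 0" for a b
    using skew_quad_form[OF hor[of a b]] by metis
  then obtain G0 where G0: "\<And>a b. linear_form (G0 a b)" "\<And>a b. G0 a b (P a b) = f a b (P a b)"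
      "\<And>a b. G0 a b (yh a b) = 0"
    by metis
  have "\<exists>G. linear_form G \<and> G (P a b) = 0 \<and> G (yh a b) = 1" for a b
    using skew_quad_form[OF hor[of a b]] by metis
  then obtain G1 where G1: "\<And>a b. linear_form (G1 a b)" "\<And>a b. G1 a b (P a b) = 0"
      "\<And>a b. G1 a b (yh a b) = 1"
    by metis
  define G where "G a b t x = G0 a b x + t * G1 a b x" for a b t x
  have G: "linear_form (G a b t)" "G a b t (P a b) = f a b (P a b)" "G a b t (yh a b) = t" for a b t
    unfolding G_def using linear_form_combination[OF G0(1) G1(1)] G0 G1 by auto
  have nz: "G1 a b x \<noteq> 0" if "x \<in> B a b" "x \<notin> vec.span {P a b}" for a b x
    by (rule skew_quad_form_nonzero[OF hor G1 that])
  have nzs: "G1 (a + 1) b (yh a b) \<noteq> 0" "G1 a b (yv a b) \<noteq> 0" "G1 a (b + 1) (yv a b) \<noteq> 0" for a b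
    using skew_quad_mem[OF hor[of a b]] skew_quad_mem[OF ver[of a b]] skew_quad_not_multiple[OF ver[of a b]]
      skew_quad_not_multiple[OF skew_quad_rotate[OF skew_quad_rotate[OF ver[of a b]]]]
      skew_quad_not_multiple[OF skew_quad_rotate[OF skew_quad_rotate[OF hor[of a b]]]]
    by (auto simp: nz)
  \<comment> \<open>Agreement along an edge of \<open>B\<close>, solved for the parameter at the far end of the edge.\<close>
  define h where "h a b t = (G0 a b (yh a b) + t * G1 a b (yh a b) - G0 (a + 1) b (yh a b)) / G1 (a + 1) b (yh a b)"
    for a b t
  define v where "v a b t = (G0 a b (yv a b) + t * G1 a b (yv a b) - G0 a (b + 1) (yv a b)) / G1 a (b + 1) (yv a b)"
    for a b t
  have h: "G a b t (yh a b) = G (a + 1) b t' (yh a b) \<longleftrightarrow> t' = h a b t" for a b t t'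
    using nzs(1)[of a b] by (auto simp: G_def h_def field_simps)
  have v: "G a b t (yv a b) = G a (b + 1) t' (yv a b) \<longleftrightarrow> t' = v a b t" for a b t t'
    using nzs(3)[of a b] by (auto simp: G_def v_def field_simps)
  have "bij (h a b)" "bij (v a b)" for a b
    unfolding h_def[abs_def] v_def[abs_def] by (rule bij_affine; use nzs G1(3) in simp)+
  moreover have "v (a + 1) b (h a b t) = h a (b + 1) (v a b t)" for a b t
  proof -
    obtain E where E: "vec.subspace E" "vec.dim E = 3" "{xh a b, xh a (b + 1), yh a b, yh a (b + 1)} \<subseteq> E"
      using coplanar by blast
    have "G a (b + 1) (v a b t) (yh a (b + 1)) = G (a + 1) (b + 1) (v (a + 1) b (h a b t)) (yh a (b + 1))"
    proof (rule cube_closes[where f = "f a b" and f' = "f (a + 1) b" and fv = "f a (b + 1)"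
          and fv' = "f (a + 1) (b + 1)" and g = "G a b t" and g' = "G (a + 1) b (h a b t)",
          OF ver[of a b] ver[of "a + 1" b] bottom[of a b] _ _ _ E])
      show "yh a b \<in> B a b \<inter> B (a + 1) b" "yh a (b + 1) \<in> B a (b + 1) \<inter> B (a + 1) (b + 1)"
        using skew_quad_mem[OF hor] by auto
      show "yh a b \<notin> vec.span {P a b}"
        by (rule skew_quad_not_multiple[OF hor])
    qed (use f G h v in \<open>simp_all\<close>)
    then show ?thesis by (simp add: h)
  qed
  \<comment> \<open>The common extension of \<open>f\<close> from the face of \<open>A\<close>; its value at \<open>yh a b\<close> is the degenerate parameter.\<close>
  moreover obtain FA where FA: "\<And>a b. linear_form (FA a b)" "\<And>a b. FA a b (xv a b) = f a b (xv a b)"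
      "\<And>a b. FA a b (xh a b) = f a b (xh a b)"
      "\<And>a b. FA a b (xv (a + 1) b) = f (a + 1) b (xv (a + 1) b)"
      "\<And>a b. FA a b (xh a (b + 1)) = f a (b + 1) (xh a (b + 1))"
  proof -
    have "\<exists>F. linear_form F \<and> F (xv a b) = f a b (xv a b) \<and> F (xh a b) = f a b (xh a b) \<and>
        F (xv (a + 1) b) = f (a + 1) b (xv (a + 1) b) \<and> F (xh a (b + 1)) = f a (b + 1) (xh a (b + 1))" for a b
      using skew_quad_form[OF bottom[of a b]] by metis
    then show thesis using that by metis
  qed
  ultimately obtain s where s: "\<And>a b. s (a + 1) b = h a b (s a b)" "\<And>a b. s a (b + 1) = v a b (s a b)"
      "\<And>a b. s a b \<noteq> FA a b (yh a b)"
    using flat_section_avoiding[of h v "\<lambda>a b. FA a b (yh a b)"] uncountable_UNIV_complex by metis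
  have "F (yh a b) \<noteq> G a b (s a b) (yh a b)"
    if F: "linear_form F" "\<forall>a'\<in>{a, a + 1}. \<forall>b'\<in>{b, b + 1}. \<forall>x\<in>A a' b'. F x = f a' b' x" for a b F
  proof -
    have "F (yh a b) = FA a b (yh a b)"
      by (rule skew_quad_form_eq[OF bottom[of a b]])
        (use F FA skew_quad_mem[OF bottom[of a b]] skew_quad_subset(4)[OF hor[of a b]] skew_quad_mem(8)[OF hor[of a b]] in auto)
    then show ?thesis using s(3)[of a b] by (simp add: G)
  qed
  moreover have "G a b (s a b) (yh a b) = G (a + 1) b (s (a + 1) b) (yh a b)"
    "G a b (s a b) (yv a b) = G a (b + 1) (s a (b + 1)) (yv a b)" for a b
    by (simp_all only: h v s)
  ultimately show ?thesis
    using G(1,2) by (intro exI[of _ "\<lambda>a b. G a b (s a b)"] conjI allI impI) blast+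
qed

definition elementary_cube :: "int^3 \<Rightarrow> (int^3) set" where
  "elementary_cube n = {m. \<forall>i. m $ i \<in> {n $ i, n $ i + 1}}"

abbreviation lattice_point :: "int \<Rightarrow> int \<Rightarrow> int \<Rightarrow> int^3" where
  "lattice_point k a b \<equiv> vector [k, a, b]"

lemma lattice_point_shift:
  "lattice_point k a b + unit_shift 1 = lattice_point (k + 1) a b"
  "lattice_point k a b + unit_shift 2 = lattice_point k (a + 1) b"
  "lattice_point k a b + unit_shift 3 = lattice_point k a (b + 1)"
  by (simp_all add: vec_eq_iff forall_3 axis_def)

lemma lattice_point_coords: "lattice_point (n $ 1) (n $ 2) (n $ 3) = n"
  by (simp add: vec_eq_iff forall_3)

text \<open>
  Slices are transversal to direction 1. The zero forms are a possible start on one slice: every cube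
  lies between two consecutive slices and becomes nondegenerate when the second of them is treated.
\<close>

lemma compatible_forms_exist:
  fixes L :: "int^3 \<Rightarrow> (complex^'n) set" and p :: "3 \<Rightarrow> int^3 \<Rightarrow> complex^'n"
  assumes quads: "\<And>n i j. i \<noteq> j \<Longrightarrow>
      skew_quad H (L n) (L (n + unit_shift i)) (L (n + unit_shift i + unit_shift j)) (L (n + unit_shift j))
        (p j n) (p i n) (p j (n + unit_shift i)) (p i (n + unit_shift j))"
    and coplanar: "\<And>n. \<exists>E. vec.subspace E \<and> vec.dim E = 3 \<and>
      {p 2 n, p 2 (n + unit_shift 1), p 2 (n + unit_shift 1 + unit_shift 3), p 2 (n + unit_shift 3)} \<subseteq> E"
  obtains \<phi> where "\<And>n. linear_form (\<phi> n)" "\<And>n i. \<phi> n (p i n) = \<phi> (n + unit_shift i) (p i n)"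
    "\<And>n F. linear_form F \<Longrightarrow> \<exists>m\<in>elementary_cube n. \<exists>x\<in>L m. F x \<noteq> \<phi> m x"
proof -
  define Slice where "Slice k f \<longleftrightarrow> (\<forall>a b. linear_form (f a b) \<and>
      f a b (p 2 (lattice_point k a b)) = f (a + 1) b (p 2 (lattice_point k a b)) \<and>
      f a b (p 3 (lattice_point k a b)) = f a (b + 1) (p 3 (lattice_point k a b)))" for k f
  define Step where "Step k f g \<longleftrightarrow> (\<forall>a b.
      f a b (p 1 (lattice_point k a b)) = g a b (p 1 (lattice_point k a b)) \<and>
      (\<forall>F. linear_form F \<longrightarrow> (\<exists>a'\<in>{a, a + 1}. \<exists>b'\<in>{b, b + 1}.
        (\<exists>x\<in>L (lattice_point k a' b'). F x \<noteq> f a' b' x) \<or>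
        (\<exists>x\<in>L (lattice_point (k + 1) a' b'). F x \<noteq> g a' b' x))))" for k f g
  note shift = lattice_point_shift
  have quads_at: "skew_quad H (L (lattice_point k a b)) (L (lattice_point k (a + 1) b))
        (L (lattice_point (k + 1) (a + 1) b)) (L (lattice_point (k + 1) a b))
        (p 1 (lattice_point k a b)) (p 2 (lattice_point k a b))
        (p 1 (lattice_point k (a + 1) b)) (p 2 (lattice_point (k + 1) a b))"
      "skew_quad H (L (lattice_point k a b)) (L (lattice_point k a (b + 1)))
        (L (lattice_point (k + 1) a (b + 1))) (L (lattice_point (k + 1) a b))
        (p 1 (lattice_point k a b)) (p 3 (lattice_point k a b))
        (p 1 (lattice_point k a (b + 1))) (p 3 (lattice_point (k + 1) a b))"
      "skew_quad H (L (lattice_point k a b)) (L (lattice_point k (a + 1) b))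
        (L (lattice_point k (a + 1) (b + 1))) (L (lattice_point k a (b + 1)))
        (p 3 (lattice_point k a b)) (p 2 (lattice_point k a b))
        (p 3 (lattice_point k (a + 1) b)) (p 2 (lattice_point k a (b + 1)))" for k a b
    using quads[of 2 1 "lattice_point k a b"] quads[of 3 1 "lattice_point k a b"]
      quads[of 2 3 "lattice_point k a b"] by (simp_all add: shift)
  have cop: "\<exists>E. vec.subspace E \<and> vec.dim E = 3 \<and>
      {p 2 (lattice_point k a b), p 2 (lattice_point (k + 1) a b),
       p 2 (lattice_point (k + 1) a (b + 1)), p 2 (lattice_point k a (b + 1))} \<subseteq> E" for k a b
    using coplanar[of "lattice_point k a b"] by (simp only: shift)
  have "Slice 0 (\<lambda>_ _ _. 0)"
    by (simp add: Slice_def form.linear_zero)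
  moreover have "\<exists>g. Slice (k + 1) g \<and> Step k f g" if "Slice k f" for k f
  proof -
    have plane: "\<exists>E. vec.subspace E \<and> vec.dim E = 3 \<and>
      {p 2 (lattice_point k a b), p 2 (lattice_point k a (b + 1)),
       p 2 (lattice_point (k + 1) a b), p 2 (lattice_point (k + 1) a (b + 1))} \<subseteq> E" for a b
      using cop[of k a b] by auto
    have form: "linear_form (f a b)"
        "f a b (p 2 (lattice_point k a b)) = f (a + 1) b (p 2 (lattice_point k a b))"
        "f a b (p 3 (lattice_point k a b)) = f a (b + 1) (p 3 (lattice_point k a b))" for a b
      using that by (auto simp: Slice_def)
    from slab_lift[where f = f and P = "\<lambda>a b. p 1 (lattice_point k a b)"
        and A = "\<lambda>a b. L (lattice_point k a b)" and B = "\<lambda>a b. L (lattice_point (k + 1) a b)"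
        and xh = "\<lambda>a b. p 2 (lattice_point k a b)" and xv = "\<lambda>a b. p 3 (lattice_point k a b)"
        and yh = "\<lambda>a b. p 2 (lattice_point (k + 1) a b)" and yv = "\<lambda>a b. p 3 (lattice_point (k + 1) a b)", OF quads_at plane form]
    obtain g where g: "\<forall>a b. linear_form (g a b) \<and>
        g a b (p 1 (lattice_point k a b)) = f a b (p 1 (lattice_point k a b)) \<and>
        g a b (p 2 (lattice_point (k + 1) a b)) = g (a + 1) b (p 2 (lattice_point (k + 1) a b)) \<and>
        g a b (p 3 (lattice_point (k + 1) a b)) = g a (b + 1) (p 3 (lattice_point (k + 1) a b))"
      "\<forall>a b F. linear_form F \<longrightarrow>
        (\<forall>a'\<in>{a, a + 1}. \<forall>b'\<in>{b, b + 1}. \<forall>x\<in>L (lattice_point k a' b'). F x = f a' b' x) \<longrightarrow>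
        F (p 2 (lattice_point (k + 1) a b)) \<noteq> g a b (p 2 (lattice_point (k + 1) a b))"
      by (elim exE conjE)
    have "Step k f g"
      unfolding Step_def
    proof (intro allI conjI impI)
      fix a b and F :: "complex^'n \<Rightarrow> complex" assume F: "linear_form F"
      have "p 2 (lattice_point (k + 1) a b) \<in> L (lattice_point (k + 1) a b)"
        using skew_quad_mem[OF quads_at(1)] by blast
      then show "\<exists>a'\<in>{a, a + 1}. \<exists>b'\<in>{b, b + 1}.
        (\<exists>x\<in>L (lattice_point k a' b'). F x \<noteq> f a' b' x) \<or>
        (\<exists>x\<in>L (lattice_point (k + 1) a' b'). F x \<noteq> g a' b' x)"
        using g(2) F by blast
    qed (simp add: g(1))
    then show ?thesis using g(1) unfolding Slice_def by auto
  qed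
  moreover have "\<exists>f. Slice k f \<and> Step k f g" if "Slice (k + 1) g" for k g
  proof -
    have plane: "\<exists>E. vec.subspace E \<and> vec.dim E = 3 \<and>
      {p 2 (lattice_point (k + 1) a b), p 2 (lattice_point (k + 1) a (b + 1)),
       p 2 (lattice_point k a b), p 2 (lattice_point k a (b + 1))} \<subseteq> E" for a b
      using cop[of k a b] by auto
    have form: "linear_form (g a b)"
        "g a b (p 2 (lattice_point (k + 1) a b)) = g (a + 1) b (p 2 (lattice_point (k + 1) a b))"
        "g a b (p 3 (lattice_point (k + 1) a b)) = g a (b + 1) (p 3 (lattice_point (k + 1) a b))" for a b
      using that by (auto simp: Slice_def)
    \<comment> \<open>Downwards: slice \<open>k + 1\<close> is given, and the side faces are traversed in reverse.\<close>
    from slab_lift[where f = g and P = "\<lambda>a b. p 1 (lattice_point k a b)"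
        and A = "\<lambda>a b. L (lattice_point (k + 1) a b)" and B = "\<lambda>a b. L (lattice_point k a b)"
        and xh = "\<lambda>a b. p 2 (lattice_point (k + 1) a b)" and xv = "\<lambda>a b. p 3 (lattice_point (k + 1) a b)"
        and yh = "\<lambda>a b. p 2 (lattice_point k a b)" and yv = "\<lambda>a b. p 3 (lattice_point k a b)", OF skew_quad_reverse[OF quads_at(1)] skew_quad_reverse[OF quads_at(2)] quads_at(3) plane form]
    obtain f where f: "\<forall>a b. linear_form (f a b) \<and>
        f a b (p 1 (lattice_point k a b)) = g a b (p 1 (lattice_point k a b)) \<and>
        f a b (p 2 (lattice_point k a b)) = f (a + 1) b (p 2 (lattice_point k a b)) \<and>
        f a b (p 3 (lattice_point k a b)) = f a (b + 1) (p 3 (lattice_point k a b))"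
      "\<forall>a b F. linear_form F \<longrightarrow>
        (\<forall>a'\<in>{a, a + 1}. \<forall>b'\<in>{b, b + 1}. \<forall>x\<in>L (lattice_point (k + 1) a' b'). F x = g a' b' x) \<longrightarrow>
        F (p 2 (lattice_point k a b)) \<noteq> f a b (p 2 (lattice_point k a b))"
      by (elim exE conjE)
    have "Step k f g"
      unfolding Step_def
    proof (intro allI conjI impI)
      fix a b and F :: "complex^'n \<Rightarrow> complex" assume F: "linear_form F"
      have "p 2 (lattice_point k a b) \<in> L (lattice_point k a b)"
        using skew_quad_mem[OF quads_at(1)] by blast
      then show "\<exists>a'\<in>{a, a + 1}. \<exists>b'\<in>{b, b + 1}.
        (\<exists>x\<in>L (lattice_point k a' b'). F x \<noteq> f a' b' x) \<or>
        (\<exists>x\<in>L (lattice_point (k + 1) a' b'). F x \<noteq> g a' b' x)"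
        using f(2) F by blast
    qed (simp add: f(1))
    then show ?thesis using f(1) unfolding Slice_def by auto
  qed
  ultimately obtain \<Phi> where \<Phi>: "\<And>k. Slice k (\<Phi> k)" "\<And>k. Step k (\<Phi> k) (\<Phi> (k + 1))"
    using int_dependent_choice[of Slice "\<lambda>_ _ _. 0" Step] by blast
  define \<phi> where "\<phi> n = \<Phi> (n $ 1) (n $ 2) (n $ 3)" for n :: "int^3"
  have lin: "linear_form (\<phi> n)" for n
    using \<Phi>(1) by (simp add: \<phi>_def Slice_def)
  have compatible: "\<phi> n (p i n) = \<phi> (n + unit_shift i) (p i n)" for n i
  proof -
    have shifted: "\<phi> (n + unit_shift 1) = \<Phi> (n $ 1 + 1) (n $ 2) (n $ 3)"
      "\<phi> (n + unit_shift 2) = \<Phi> (n $ 1) (n $ 2 + 1) (n $ 3)"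
      "\<phi> (n + unit_shift 3) = \<Phi> (n $ 1) (n $ 2) (n $ 3 + 1)"
      by (simp_all add: \<phi>_def axis_def)
    have "\<phi> n (p 1 n) = \<phi> (n + unit_shift 1) (p 1 n)"
      using \<Phi>(2)[of "n $ 1", unfolded Step_def, THEN spec[of _ "n $ 2"], THEN spec[of _ "n $ 3"]]
      unfolding shifted by (simp add: lattice_point_coords \<phi>_def)
    moreover have "\<phi> n (p 2 n) = \<phi> (n + unit_shift 2) (p 2 n)"
      "\<phi> n (p 3 n) = \<phi> (n + unit_shift 3) (p 3 n)"
      using \<Phi>(1)[of "n $ 1", unfolded Slice_def, THEN spec[of _ "n $ 2"], THEN spec[of _ "n $ 3"]]
      unfolding shifted by (simp_all add: lattice_point_coords \<phi>_def)
    ultimately show ?thesis using exhaust_3[of i] by (elim disjE) simp_all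
  qed
  have nontrivial: "\<exists>m\<in>elementary_cube n. \<exists>x\<in>L m. F x \<noteq> \<phi> m x" if F: "linear_form F" for n F
  proof -
    obtain a b where ab: "a \<in> {n $ 2, n $ 2 + 1}" "b \<in> {n $ 3, n $ 3 + 1}"
      "(\<exists>x\<in>L (lattice_point (n $ 1) a b). F x \<noteq> \<Phi> (n $ 1) a b x) \<or>
       (\<exists>x\<in>L (lattice_point (n $ 1 + 1) a b). F x \<noteq> \<Phi> (n $ 1 + 1) a b x)"
      using \<Phi>(2)[of "n $ 1", unfolded Step_def, THEN spec[of _ "n $ 2"], THEN spec[of _ "n $ 3"]] F by blast
    have vertices: "lattice_point (n $ 1) a b \<in> elementary_cube n"
      "lattice_point (n $ 1 + 1) a b \<in> elementary_cube n"
      using ab(1,2) by (simp_all add: elementary_cube_def forall_3)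
    have \<phi>_vertex: "\<phi> (lattice_point k a b) = \<Phi> k a b" for k
      by (simp add: \<phi>_def)
    from ab(3) show ?thesis
    proof
      assume "\<exists>x\<in>L (lattice_point (n $ 1) a b). F x \<noteq> \<Phi> (n $ 1) a b x"
      then show ?thesis
        unfolding \<phi>_vertex[symmetric] by (rule bexI) (rule vertices)
    next
      assume "\<exists>x\<in>L (lattice_point (n $ 1 + 1) a b). F x \<noteq> \<Phi> (n $ 1 + 1) a b x"
      then show ?thesis
        unfolding \<phi>_vertex[symmetric] by (rule bexI) (rule vertices)
    qed
  qed
  show thesis using that[OF lin compatible nontrivial] .
qed

section \<open>Line complexes in general position\<close>

lemma linear_add_form:
  fixes F :: "complex^'n \<Rightarrow> complex"
  assumes "linear_form F"
  shows "Vector_Spaces.linear (*s) (*s) (\<lambda>v. v + F v *s c)"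
    and "Vector_Spaces.linear (*s) (*s) (\<lambda>v. v - F v *s c)"
  using assms by (simp_all add: Vector_Spaces.linear_iff vec_eq_iff algebra_simps)

lemma span_subspace_pair:
  fixes K :: "(complex^'n) set"
  assumes "vec.subspace K" "vec.dim K = 2" "x \<in> K" "y \<in> K" "x \<noteq> 0" "vec.span {x} \<noteq> vec.span {y}" "y \<noteq> 0"
  shows "K = vec.span {x, y}"
proof -
  have "y \<notin> vec.span {x}"
  proof
    assume "y \<in> vec.span {x}"
    then obtain a where a: "y = a *s x" by (auto simp: vec.span_insert)
    with assms have "x = (1 / a) *s y" by auto
    then have "x \<in> vec.span {y}" by (metis vec.span_base vec.span_scale singletonI)
    with \<open>y \<in> vec.span {x}\<close> have "vec.span {x} = vec.span {y}"
      by (intro equalityI vec.span_minimal) auto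
    with assms show False by simp
  qed
  with assms have "vec.independent {y, x}" "x \<noteq> y"
    by (auto simp: vec.independent_insert intro: vec.span_base)
  then have "vec.dim (vec.span {x, y}) = 2"
    by (subst vec.dim_span_eq_card_independent) (auto simp: insert_commute)
  then show ?thesis
    using assms by (intro vec.subspace_dim_equal[symmetric] vec.span_minimal) auto
qed

lemma proj_point_obtain:
  fixes U :: "(complex^'n) set"
  assumes "proj_point U"
  obtains u where "u \<noteq> 0" "U = vec.span {u}"
proof -
  obtain B where B: "vec.independent B" "vec.span B = U" "card B = 1"
    using assms vec.basis_subspace_exists[of U] by (auto simp: proj_subspace_def)
  then obtain u where "B = {u}" by (auto simp: card_1_singleton_iff)
  with B that[of u] show thesis by auto
qed

lemma proj_point_span: "u \<noteq> 0 \<Longrightarrow> proj_point (vec.span {u :: complex^'n})"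
  by (simp add: proj_subspace_def)

lemma proj_point_eq_span:
  fixes U :: "(complex^'n) set"
  assumes "proj_point U" "u \<in> U" "u \<noteq> 0"
  shows "U = vec.span {u}"
  using assms by (intro vec.subspace_dim_equal[symmetric] vec.span_minimal) (auto simp: proj_subspace_def)

lemma line_complex_line:
  assumes "line_complex_in S L"
  shows "vec.subspace (L n)" "vec.dim (L n) = 2" "L n \<subseteq> S"
  using assms by (auto simp: line_complex_in_def proj_subspace_def)

lemma general_position_points:
  assumes "general_position L" "i \<noteq> j" "s \<in> {-1, 1}" "t \<in> {-1, 1}"
    and "proj_point P" "P \<subseteq> L n \<inter> L (n + axis i s)" "proj_point Q" "Q \<subseteq> L n \<inter> L (n + axis j t)"
  shows "P \<noteq> Q"
proof -
  have "\<forall>n i j P Q. \<forall>s\<in>{-1, 1}. \<forall>t\<in>{-1, 1}. i \<noteq> j \<longrightarrow>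
      proj_point P \<longrightarrow> P \<subseteq> L n \<inter> L (n + axis i s) \<longrightarrow>
      proj_point Q \<longrightarrow> Q \<subseteq> L n \<inter> L (n + axis j t) \<longrightarrow> P \<noteq> Q"
    using assms(1) unfolding general_position_def by (elim conjE)
  from this[rule_format, OF assms(3,4,2,5-8)] show ?thesis .
qed

lemma general_position_neighbours:
  assumes "general_position L"
  shows "L n \<noteq> L (n + unit_shift i)"
  using conjunct1[OF assms[unfolded general_position_def]] by (elim allE)

lemma general_position_face:
  assumes "general_position L" "i \<noteq> j"
  shows "proj_subspace 3 (face_span L i j n)"
  using conjunct2[OF conjunct2[OF assms(1)[unfolded general_position_def]]] assms(2) by (elim allE impE)

text \<open>
  General position separates the points attached to edges of different directions, whichever way
  the edges point from \<open>n\<close>; this covers the line at each of the four vertices of a face.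
\<close>

lemma general_position_span:
  fixes L :: "int^3 \<Rightarrow> (complex^'n) set"
  assumes "general_position L" "line_complex_in S L" "i \<noteq> j" "s \<in> {-1, 1}" "t \<in> {-1, 1}"
    and "x \<in> L n \<inter> L (n + axis i s)" "y \<in> L n \<inter> L (n + axis j t)" "x \<noteq> 0" "y \<noteq> 0"
  shows "L n = vec.span {x, y}"
proof (rule span_subspace_pair)
  have "vec.span {x} \<subseteq> L n \<inter> L (n + axis i s)" "vec.span {y} \<subseteq> L n \<inter> L (n + axis j t)"
    using assms(6,7) by (intro vec.span_minimal vec.subspace_inter line_complex_line[OF assms(2)]; simp)+
  with assms show "vec.span {x} \<noteq> vec.span {y}"
    by (intro general_position_points[OF assms(1,3-5)] proj_point_span)
qed (use assms line_complex_line in auto)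

text \<open>
  By the previous lemma each of the four lines is spanned by its two vertices, so the vertices span
  the span of the face. As this has dimension four, they are distinct and independent.
\<close>

lemma general_position_skew_quad:
  fixes L :: "int^3 \<Rightarrow> (complex^'n) set"
  assumes gp: "general_position L" and L: "line_complex_in H L" and H: "proj_subspace 3 H"
    and p: "\<And>i n. p i n \<noteq> 0" "\<And>i n. p i n \<in> L n" "\<And>i n. p i n \<in> L (n + unit_shift i)"
    and ij: "i \<noteq> j"
  shows "skew_quad H (L n) (L (n + unit_shift i)) (L (n + unit_shift i + unit_shift j)) (L (n + unit_shift j))
        (p j n) (p i n) (p j (n + unit_shift i)) (p i (n + unit_shift j))"
proof -
  let ?S = "{p j n, p i n, p j (n + unit_shift i), p i (n + unit_shift j)}"
  have neg: "axis k (- 1) = - unit_shift k" for k :: 3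
    by (simp add: vec_eq_iff axis_def)
  note sp = general_position_span[OF gp L]
  have 1: "L n = vec.span {p j n, p i n}"
    using ij p(1) p(2,3)[of j n] p(2,3)[of i n]
    by (intro sp[of j i 1 1]) auto
  have 2: "L (n + unit_shift i) = vec.span {p i n, p j (n + unit_shift i)}"
    using ij p(1) p(2,3)[of i n] p(2,3)[of j "n + unit_shift i"]
    by (intro sp[of i j "-1" 1]) (auto simp: neg)
  have 3: "L (n + unit_shift i + unit_shift j) = vec.span {p j (n + unit_shift i), p i (n + unit_shift j)}"
    using ij p(1) p(2,3)[of j "n + unit_shift i"] p(2,3)[of i "n + unit_shift j"]
    by (intro sp[of j i "-1" "-1"]) (auto simp: neg algebra_simps)
  have 4: "L (n + unit_shift j) = vec.span {p i (n + unit_shift j), p j n}"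
    using ij p(1) p(2,3)[of j n] p(2,3)[of i "n + unit_shift j"]
    by (intro sp[of i j 1 "-1"]) (auto simp: neg)
  have face: "face_span L i j n = vec.span ?S"
    unfolding face_span_def
  proof (intro equalityI vec.span_minimal)
    show "L n \<union> L (n + unit_shift i) \<union> L (n + unit_shift j) \<union> L (n + unit_shift i + unit_shift j) \<subseteq> vec.span ?S"
      unfolding 1 2 3 4 by (intro Un_least vec.span_mono) auto
    show "?S \<subseteq> vec.span (L n \<union> L (n + unit_shift i) \<union> L (n + unit_shift j) \<union> L (n + unit_shift i + unit_shift j))"
      using p(2) vec.span_superset[of "L n \<union> L (n + unit_shift i) \<union> L (n + unit_shift j) \<union>
        L (n + unit_shift i + unit_shift j)"] by blast
  qed auto
  have dim: "vec.dim (vec.span ?S) = 4"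
  proof -
    have "proj_subspace 3 (face_span L i j n)"
      by (rule general_position_face[OF gp ij])
    then show ?thesis by (simp add: face proj_subspace_def)
  qed
  then have "card ?S \<ge> 4"
    using vec.dim_le_card[of ?S ?S] vec.span_superset[of ?S] by simp
  moreover have "card ?S \<le> 4"
    using card_length[of "[p j n, p i n, p j (n + unit_shift i), p i (n + unit_shift j)]"] by simp
  ultimately have card: "card ?S = 4" by simp
  then have distinct: "distinct [p j n, p i n, p j (n + unit_shift i), p i (n + unit_shift j)]"
    by (intro card_distinct) simp
  have independent: "vec.independent ?S"
    using dim card by (intro vec.card_le_dim_spanning[of ?S "vec.span ?S"]) (auto intro: vec.span_base)
  have span: "H = vec.span ?S"
  proof (rule vec.subspace_dim_equal[symmetric])
    show "vec.span ?S \<subseteq> H"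
      using p(2) line_complex_line(3)[OF L] H by (intro vec.span_minimal) (auto simp: proj_subspace_def)
  qed (use H dim in \<open>auto simp: proj_subspace_def\<close>)
  show ?thesis
    unfolding skew_quad_def by (intro conjI) (fact distinct independent span 1 2 3 4)+
qed

section \<open>Projections of fundamental line complexes are fundamental\<close>

text \<open>
  The form that vanishes on \<open>H\<close> and is normalised at the centre turns the projection into the linear
  map \<open>x \<mapsto> x - \<kappa> x c\<close>, as the next lemma shows.
\<close>

lemma hyperplane_form:
  fixes H :: "(complex^'n) set"
  assumes H: "vec.subspace H" "vec.dim H + 1 = CARD('n)" and c: "c \<notin> H"
  obtains \<kappa> where "linear_form \<kappa>" "\<kappa> c = 1" "\<And>x. \<kappa> x = 0 \<longleftrightarrow> x \<in> H"
proof -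
  obtain B where fin: "finite B" and "B \<subseteq> H"
    and B: "vec.independent B" "vec.span B = H" "card B = vec.dim H"
    using vec.basis_subspace_exists[OF H(1)] .
  have cB: "c \<notin> B" "vec.independent (insert c B)"
    using c B(2) vec.span_base vec.independent_insertI[OF _ B(1)] by auto
  obtain \<kappa> where \<kappa>: "linear_form \<kappa>" "\<forall>x\<in>insert c B. \<kappa> x = (if x = c then 1 else 0)"
    using form.linear_independent_extend[OF cB(2), of "\<lambda>x. if x = c then 1 else 0"] by blast
  have "\<forall>x\<in>B. \<kappa> x = 0"
    using \<kappa>(2) cB(1) by auto
  then have zero: "\<kappa> x = 0" if "x \<in> H" for x
    using form.linear_eq_on_span[OF \<kappa>(1) form.linear_zero, of B x] that B(2) by blast
  have "vec.span (insert c B) = UNIV"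
    using vec.card_eq_dim[of "insert c B" UNIV] cB fin B(3) H(2) by (auto simp: card_cart_basis)
  have "x \<in> H" if "\<kappa> x = 0" for x
  proof -
    obtain k where k: "x - k *s c \<in> H"
      using \<open>vec.span (insert c B) = UNIV\<close> B(2) by (auto simp: vec.span_insert)
    have "k = 0"
      using zero[OF k] that \<kappa> by (simp add: linear_form_diff linear_form_scale)
    with k show ?thesis by simp
  qed
  with zero \<kappa>(2) show thesis
    by (intro that[of \<kappa>] \<kappa>(1)) auto
qed

lemma central_projection_image:
  fixes \<kappa> :: "complex^'n \<Rightarrow> complex"
  assumes \<kappa>: "linear_form \<kappa>" "\<kappa> c = 1" "\<And>x. \<kappa> x = 0 \<longleftrightarrow> x \<in> H" and X: "vec.subspace X"
  shows "central_projection (vec.span {c}) H X = (\<lambda>x. x - \<kappa> x *s c) ` X"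
proof -
  have "vec.span (vec.span {c} \<union> X) = vec.span (insert c X)"
  proof (intro equalityI vec.span_minimal Un_least)
    show "{c} \<subseteq> vec.span (insert c X)"
      using vec.span_superset[of "insert c X"] by blast
    show "X \<subseteq> vec.span (insert c X)"
      using vec.span_superset[of "insert c X"] by blast
    show "insert c X \<subseteq> vec.span (vec.span {c} \<union> X)"
      using vec.span_superset[of "{c}"] vec.span_superset[of "vec.span {c} \<union> X"] by blast
  qed simp_all
  also have "\<dots> \<inter> H = (\<lambda>x. x - \<kappa> x *s c) ` X"
  proof (intro equalityI subsetI)
    fix y assume y: "y \<in> vec.span (insert c X) \<inter> H"
    then obtain k where "y - k *s c \<in> X"
      using X unfolding vec.span_insert by (auto simp: vec.span_eq_iff[THEN iffD2])
    moreover have "y = (y - k *s c) - \<kappa> (y - k *s c) *s c"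
      using y \<kappa> by (simp add: linear_form_diff linear_form_scale vec_eq_iff)
    ultimately show "y \<in> (\<lambda>x. x - \<kappa> x *s c) ` X" by blast
  next
    fix y assume "y \<in> (\<lambda>x. x - \<kappa> x *s c) ` X"
    then obtain x where x: "x \<in> X" "y = x - \<kappa> x *s c" by auto
    have "x - \<kappa> x *s c \<in> vec.span (insert c X)"
      by (intro vec.span_diff vec.span_scale vec.span_base) (simp_all add: x)
    moreover have "\<kappa> (x - \<kappa> x *s c) = 0"
      using \<kappa> by (simp add: linear_form_diff linear_form_scale)
    ultimately show "y \<in> vec.span (insert c X) \<inter> H"
      using \<kappa>(3) x(2) by simp
  qed
  finally show ?thesis by (simp add: central_projection_def)
qed

text \<open>
  The projected plane contains the four points but might degenerate to a line, namely when the
  centre lies in it; enlarging the image avoids the case distinction.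
\<close>

lemma subspace_superset_of_dim:
  fixes S :: "(complex^'n) set"
  assumes "vec.subspace S" "vec.dim S \<le> k" "k \<le> CARD('n)"
  obtains T where "vec.subspace T" "S \<subseteq> T" "vec.dim T = k"
proof -
  obtain B where "finite B" "B \<subseteq> S"
    and B: "vec.independent B" "vec.span B = S" "card B = vec.dim S"
    using vec.basis_subspace_exists[OF assms(1)] .
  obtain B' where B': "B \<subseteq> B'" "B' \<subseteq> UNIV" "vec.independent B'" "UNIV \<subseteq> vec.span B'"
    using vec.maximal_independent_subset_extend[OF subset_UNIV B(1)] .
  have "card B' = CARD('n)"
    using vec.basis_card_eq_dim[OF subset_UNIV B'(4,3)] unfolding vec_dim_card .
  then have "card B \<le> k" "k \<le> card B'"
    using B(3) assms(2,3) by simp_all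
  then obtain D where D: "B \<subseteq> D" "D \<subseteq> B'" "card D = k"
    using exists_subset_between[OF _ _ B'(1) vec.finiteI_independent[OF B'(3)]] by metis
  show thesis
  proof (rule that[of "vec.span D"])
    show "S \<subseteq> vec.span D" using B(2) vec.span_mono[OF D(1)] by simp
    show "vec.dim (vec.span D) = k"
      using vec.dim_span_eq_card_independent[OF vec.independent_mono[OF B'(3) D(2)]] D(3) by simp
  qed simp
qed

lemma meet_point_proj_point:
  fixes L :: "int^3 \<Rightarrow> (complex^'n) set"
  assumes "line_complex_in S L" "L n \<noteq> L (n + unit_shift i)"
    and "x \<in> L n" "x \<in> L (n + unit_shift i)" "x \<noteq> 0"
  shows "proj_point (meet_point L i n)"
proof -
  have sub: "vec.subspace (meet_point L i n)"
    unfolding meet_point_def by (intro vec.subspace_inter line_complex_line[OF assms(1)])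
  have "vec.dim {x} \<le> vec.dim (meet_point L i n)"
    using assms by (intro vec.dim_subset) (auto simp: meet_point_def)
  moreover have "vec.dim (meet_point L i n) < 2"
  proof (rule ccontr)
    assume "\<not> vec.dim (meet_point L i n) < 2"
    then have "meet_point L i n = L m" if "m = n \<or> m = n + unit_shift i" for m
      using that line_complex_line[OF assms(1)] sub
      by (intro vec.subspace_dim_equal) (auto simp: meet_point_def)
    with assms(2) show False by metis
  qed
  ultimately show ?thesis
    using sub assms(5) by (simp add: proj_subspace_def)
qed

lemma face_span_contains:
  "L n \<subseteq> face_span L i j n" "L (n + unit_shift i) \<subseteq> face_span L i j n"
  "L (n + unit_shift j) \<subseteq> face_span L i j n"
  "L (n + unit_shift i + unit_shift j) \<subseteq> face_span L i j n"
  unfolding face_span_def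
  using vec.span_superset[of "L n \<union> L (n + unit_shift i) \<union> L (n + unit_shift j) \<union>
    L (n + unit_shift i + unit_shift j)"] by blast+

lemma dim_inter_hyperplanes:
  fixes S T :: "(complex^'n) set"
  assumes "vec.subspace S" "vec.subspace T" "vec.dim S + 1 = CARD('n)" "vec.dim T + 1 = CARD('n)" "S \<noteq> T"
  shows "vec.dim (S \<inter> T) + 2 = CARD('n)"
proof -
  let ?U = "{x + y |x y. x \<in> S \<and> y \<in> T}"
  have U: "vec.subspace ?U" "S \<subseteq> ?U" "T \<subseteq> ?U"
  proof -
    show "vec.subspace ?U"
      by (rule vec.subspace_sums[OF assms(1,2)])
    have "x + 0 \<in> ?U" if "x \<in> S" for x
      using that vec.subspace_0[OF assms(2)] by blast
    then show "S \<subseteq> ?U" by auto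
    have "0 + y \<in> ?U" if "y \<in> T" for y
      using that vec.subspace_0[OF assms(1)] by blast
    then show "T \<subseteq> ?U" by auto
  qed
  have "vec.dim S < vec.dim ?U"
  proof (rule ccontr)
    assume "\<not> vec.dim S < vec.dim ?U"
    then have "S = ?U" "T = ?U"
      using assms U by (intro vec.subspace_dim_equal; simp)+
    with assms show False by simp
  qed
  moreover have "vec.dim ?U \<le> CARD('n)"
    using vec.dim_subset_UNIV[of ?U] by (simp add: card_cart_basis vec.dimension_def)
  moreover have "vec.dim ?U + vec.dim (S \<inter> T) = vec.dim S + vec.dim T"
    by (rule vec.dim_sums_Int[OF assms(1,2)])
  ultimately show ?thesis using assms by linarith
qed

text \<open>
  The coplanarity property follows from the fact that the points \<open>p\<^sup>l\<close> at the corners of a face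
  belong to the hyperplanes of both this face and the opposite one, which intersect in a plane.
\<close>

lemma projection_fundamental:
  fixes L Lhat :: "int^3 \<Rightarrow> (complex^5) set" and \<kappa> :: "complex^5 \<Rightarrow> complex"
  assumes L: "line_complex_in H L" "general_position L"
    and Lhat: "line_complex_in UNIV Lhat" "general_position_CP4 Lhat" "fundamental_CP4 Lhat"
    and \<kappa>: "linear_form \<kappa>"
    and centre: "\<And>n. c \<notin> Lhat n"
    and image: "\<And>n. L n = (\<lambda>x. x - \<kappa> x *s c) ` Lhat n"
  shows "fundamental_CP3 L"
proof -
  define \<pi> where "\<pi> x = x - \<kappa> x *s c" for x
  have lin: "Vector_Spaces.linear (*s) (*s) \<pi>"
    using linear_add_form(2)[OF \<kappa>] by (simp add: \<pi>_def[abs_def])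
  have \<pi>: "\<pi> x \<in> L n" if "x \<in> Lhat n" for x n
    using image[of n] that by (auto simp: \<pi>_def)
  have nonzero: "\<pi> x \<noteq> 0" if "x \<in> Lhat n" "x \<noteq> 0" for x n
  proof
    assume "\<pi> x = 0"
    then have x: "x = \<kappa> x *s c" by (simp add: \<pi>_def)
    with that(2) have "\<kappa> x \<noteq> 0" by auto
    with x have "c = (1 / \<kappa> x) *s x"
      by (metis divide_self_if mult.commute times_divide_eq_right mult_1_right vector_smult_assoc
          vector_smult_lid)
    with that(1) centre[of n] line_complex_line(1)[OF Lhat(1)] show False
      by (metis vec.subspace_scale)
  qed
  have ex: "\<exists>x. x \<noteq> 0 \<and> x \<in> Lhat n \<and> x \<in> Lhat (n + unit_shift i)" for i n
  proof -
    have "proj_point (meet_point Lhat i n)"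
      using Lhat(3) by (simp add: fundamental_CP4_def neighbours_intersect_def)
    then obtain x where x: "x \<noteq> 0" "meet_point Lhat i n = vec.span {x}"
      by (rule proj_point_obtain)
    have "x \<in> meet_point Lhat i n"
      unfolding x(2) by (simp add: vec.span_base)
    with x(1) show ?thesis
      by (intro exI[of _ x]) (simp add: meet_point_def)
  qed
  define x where "x i n = (SOME x. x \<noteq> 0 \<and> x \<in> Lhat n \<and> x \<in> Lhat (n + unit_shift i))" for i n
  have x: "x i n \<noteq> 0" "x i n \<in> Lhat n" "x i n \<in> Lhat (n + unit_shift i)" for i n
    using someI_ex[OF ex[of n i]] by (simp_all add: x_def)
  have point: "proj_point (meet_point L i n)" for i n
  proof (rule meet_point_proj_point[OF L(1)])
    show "L n \<noteq> L (n + unit_shift i)"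
      by (rule general_position_neighbours[OF L(2)])
    show "\<pi> (x i n) \<in> L n" "\<pi> (x i n) \<in> L (n + unit_shift i)"
      by (intro \<pi> x)+
    show "\<pi> (x i n) \<noteq> 0"
      by (rule nonzero[OF x(2,1)])
  qed
  have meet: "meet_point L i n = vec.span {\<pi> (x i n)}" for i n
  proof (rule proj_point_eq_span[OF point])
    show "\<pi> (x i n) \<in> meet_point L i n"
      unfolding meet_point_def by (intro IntI \<pi> x)
    show "\<pi> (x i n) \<noteq> 0"
      by (rule nonzero[OF x(2,1)])
  qed
  have coplanar: "\<exists>E. proj_plane E \<and> meet_point L l n \<subseteq> E \<and> meet_point L l (n + unit_shift m) \<subseteq> E \<and>
           meet_point L l (n + unit_shift m + unit_shift p) \<subseteq> E \<and> meet_point L l (n + unit_shift p) \<subseteq> E"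
    if lmp: "l \<noteq> m" "l \<noteq> p" "m \<noteq> p" for n l m p
  proof -
    define S T where "S = face_span Lhat m p n" and "T = face_span Lhat m p (n + unit_shift l)"
    have "general_position Lhat"
      using Lhat(2) by (simp add: general_position_CP4_def)
    then have "proj_subspace 3 S" "proj_subspace 3 T"
      unfolding S_def T_def by (rule general_position_face[OF _ lmp(3)])+
    then have ST: "vec.subspace S" "vec.subspace T" "vec.dim S = 4" "vec.dim T = 4"
      by (simp_all add: proj_subspace_def)
    have "S \<noteq> T"
      using conjunct2[OF Lhat(2)[unfolded general_position_CP4_def]] lmp
      unfolding S_def T_def by (elim allE impE) auto
    with ST have dim: "vec.dim (S \<inter> T) = 3"
      using dim_inter_hyperplanes[of S T] ST by simp
    have sub: "vec.subspace (\<pi> ` (S \<inter> T))"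
      using ST by (intro vec.linear_subspace_image[OF lin] vec.subspace_inter)
    moreover have "vec.dim (\<pi> ` (S \<inter> T)) \<le> 3"
      using vec.dim_image_le[OF lin, of "S \<inter> T"] dim by simp
    ultimately obtain E where E: "vec.subspace E" "\<pi> ` (S \<inter> T) \<subseteq> E" "vec.dim E = 3"
      by (rule subspace_superset_of_dim) auto
    have "meet_point L l k \<subseteq> E"
      if "k \<in> {n, n + unit_shift m, n + unit_shift p, n + unit_shift m + unit_shift p}" for k
    proof -
      have "x l k \<in> S"
        using that x(2)[of l k] face_span_contains[where L = Lhat and n = n and i = m and j = p] by (auto simp: S_def)
      moreover have "x l k \<in> T"
        using that x(3)[of l k] face_span_contains[where L = Lhat and n = "n + unit_shift l" and i = m and j = p]
        by (auto simp: T_def algebra_simps)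
      ultimately show ?thesis
        unfolding meet using E by (intro vec.span_minimal) auto
    qed
    with E show ?thesis by (intro exI[of _ E]) (simp add: proj_subspace_def)
  qed
  show ?thesis
    unfolding fundamental_CP3_def neighbours_intersect_def coplanarity_property_def
    by (intro conjI allI impI point coplanar) simp_all
qed

section \<open>Lifting a fundamental line complex\<close>

text \<open>
  The forms from which the lift is built. The third property makes opposite hyperplanes of a cube
  distinct, the fourth makes the lift of a face lie in a hyperplane.
\<close>

lemma fundamental_compatible_forms:
  fixes L :: "int^3 \<Rightarrow> (complex^'n) set"
  assumes H: "proj_subspace 3 H" and L: "line_complex_in H L" "general_position L" "fundamental_CP3 L"
  obtains \<phi> where "\<And>n. linear_form (\<phi> n)"
    "\<And>n i x. x \<in> meet_point L i n \<Longrightarrow> \<phi> n x = \<phi> (n + unit_shift i) x"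
    "\<And>n F. linear_form F \<Longrightarrow> \<exists>m\<in>elementary_cube n. \<exists>x\<in>L m. F x \<noteq> \<phi> m x"
    "\<And>n i j. i \<noteq> j \<Longrightarrow> \<exists>F. linear_form F \<and>
      (\<forall>m\<in>{n, n + unit_shift i, n + unit_shift j, n + unit_shift i + unit_shift j}. \<forall>x\<in>L m. F x = \<phi> m x)"
proof -
  have point: "proj_point (meet_point L i n)" for i n
    using L(3) by (simp add: fundamental_CP3_def neighbours_intersect_def)
  have "\<exists>u. u \<noteq> 0 \<and> meet_point L i n = vec.span {u}" for i n
    using proj_point_obtain[OF point[of i n]] by metis
  then obtain p where p: "\<And>i n. p i n \<noteq> 0" and meet: "\<And>i n. meet_point L i n = vec.span {p i n}"
    by metis
  have in_meet: "p i n \<in> meet_point L i n" for i n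
    by (simp add: meet vec.span_base)
  then have mem: "p i n \<in> L n" "p i n \<in> L (n + unit_shift i)" for i n
    by (auto simp: meet_point_def)
  note quads = general_position_skew_quad[OF L(2,1) H p mem]
  have "\<exists>E. vec.subspace E \<and> vec.dim E = 3 \<and>
      {p 2 n, p 2 (n + unit_shift 1), p 2 (n + unit_shift 1 + unit_shift 3), p 2 (n + unit_shift 3)} \<subseteq> E" for n
  proof -
    have "\<exists>E. proj_plane E \<and> meet_point L 2 n \<subseteq> E \<and> meet_point L 2 (n + unit_shift 1) \<subseteq> E \<and>
           meet_point L 2 (n + unit_shift 1 + unit_shift 3) \<subseteq> E \<and> meet_point L 2 (n + unit_shift 3) \<subseteq> E"
      using L(3) unfolding fundamental_CP3_def coplanarity_property_def by simp
    then obtain E where "proj_plane E" and E: "meet_point L 2 n \<subseteq> E" "meet_point L 2 (n + unit_shift 1) \<subseteq> E"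
        "meet_point L 2 (n + unit_shift 1 + unit_shift 3) \<subseteq> E" "meet_point L 2 (n + unit_shift 3) \<subseteq> E"
      by blast
    have "p 2 n \<in> E" "p 2 (n + unit_shift 1) \<in> E" "p 2 (n + unit_shift 1 + unit_shift 3) \<in> E"
      "p 2 (n + unit_shift 3) \<in> E"
      using E in_meet by blast+
    with \<open>proj_plane E\<close> show ?thesis
      by (auto simp: proj_subspace_def)
  qed
  from compatible_forms_exist[of H L p, OF quads this]
  obtain \<phi> where \<phi>: "\<And>n. linear_form (\<phi> n)" "\<And>n i. \<phi> n (p i n) = \<phi> (n + unit_shift i) (p i n)"
    "\<And>n F. linear_form F \<Longrightarrow> \<exists>m\<in>elementary_cube n. \<exists>x\<in>L m. F x \<noteq> \<phi> m x"
    by blast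
  have agree: "\<phi> n x = \<phi> (n + unit_shift i) x" if "x \<in> meet_point L i n" for n i x
    by (rule form.linear_eq_on_span[of _ _ "{p i n}"]) (use that \<phi>(1,2) meet in auto)
  have faces: "\<exists>F. linear_form F \<and>
      (\<forall>m\<in>{n, n + unit_shift i, n + unit_shift j, n + unit_shift i + unit_shift j}. \<forall>x\<in>L m. F x = \<phi> m x)"
    if ij: "i \<noteq> j" for n i j
  proof -
    note Q = quads[OF ij, of n]
    let ?ni = "n + unit_shift i" and ?nj = "n + unit_shift j"
    obtain F where F: "linear_form F" "F (p j n) = \<phi> n (p j n)" "F (p i n) = \<phi> n (p i n)"
        "F (p j ?ni) = \<phi> ?ni (p j ?ni)" "F (p i ?nj) = \<phi> ?nj (p i ?nj)"
      using skew_quad_form[OF Q] by metis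
    have lines: "L n = vec.span {p j n, p i n}" "L ?ni = vec.span {p i n, p j ?ni}"
      "L (?ni + unit_shift j) = vec.span {p j ?ni, p i ?nj}" "L ?nj = vec.span {p i ?nj, p j n}"
      using Q by (auto simp: skew_quad_def)
    have corner: "\<phi> ?nj (p i ?nj) = \<phi> (?ni + unit_shift j) (p i ?nj)"
      using \<phi>(2)[of ?nj i] by (simp add: algebra_simps)
    have "F x = \<phi> n x" if "x \<in> L n" for x
      by (rule linear_form_eq_pair[OF F(1) \<phi>(1) _ _ that[unfolded lines]]) (use F in auto)
    moreover have "F x = \<phi> ?ni x" if "x \<in> L ?ni" for x
      by (rule linear_form_eq_pair[OF F(1) \<phi>(1) _ _ that[unfolded lines]]) (use F \<phi>(2) in auto)
    moreover have "F x = \<phi> ?nj x" if "x \<in> L ?nj" for x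
      by (rule linear_form_eq_pair[OF F(1) \<phi>(1) _ _ that[unfolded lines]]) (use F \<phi>(2) in auto)
    moreover have "F x = \<phi> (?ni + unit_shift j) x" if "x \<in> L (?ni + unit_shift j)" for x
      by (rule linear_form_eq_pair[OF F(1) \<phi>(1) _ _ that[unfolded lines]]) (use F \<phi>(2)[of ?ni j] corner in auto)
    ultimately show ?thesis using F(1) by blast
  qed
  show thesis
    by (rule that[of \<phi>]) (fact \<phi>(1) agree \<phi>(3) faces)+
qed

lemma elementary_cube_faces:
  assumes "i \<noteq> j" "i \<noteq> k" "j \<noteq> k" "m \<in> elementary_cube n"
  shows "m \<in> {n, n + unit_shift j, n + unit_shift k, n + unit_shift j + unit_shift k} \<or>
    m \<in> {n + unit_shift i, n + unit_shift i + unit_shift j, n + unit_shift i + unit_shift k,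
      n + unit_shift i + unit_shift j + unit_shift k}"
proof -
  have all: "(\<forall>h. P h) \<longleftrightarrow> P i \<and> P j \<and> P k" for P :: "3 \<Rightarrow> bool"
    using assms(1-3) exhaust_3[of i] exhaust_3[of j] exhaust_3[of k] by (auto simp: forall_3)
  show ?thesis
    using assms by (auto simp: elementary_cube_def vec_eq_iff all axis_def)
qed

text \<open>
  The graphs of the forms project back to \<open>L\<close>, and most genericity conditions upstairs follow from
  those of \<open>L\<close> because the projection is injective on each graph. The lift of a face spans the graph of the
  common extension \<open>F\<close> over \<open>H\<close>, a hyperplane not containing \<open>c\<close>. If opposite faces spanned the same
  graph, then \<open>F\<close> would restrict to all eight forms of the cube.
\<close>

lemma graph_lift_properties:
  fixes L :: "int^3 \<Rightarrow> (complex^5) set" and \<kappa> :: "complex^5 \<Rightarrow> complex"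
  assumes H: "proj_subspace 3 H" and L: "line_complex_in H L" "general_position L"
    and \<kappa>: "linear_form \<kappa>" "\<kappa> c = 1" "\<And>x. \<kappa> x = 0 \<longleftrightarrow> x \<in> H"
    and point: "\<And>i n. proj_point (meet_point L i n)"
    and \<phi>: "\<And>n. linear_form (\<phi> n)"
      "\<And>n i x. x \<in> meet_point L i n \<Longrightarrow> \<phi> n x = \<phi> (n + unit_shift i) x"
      "\<And>n F. linear_form F \<Longrightarrow> \<exists>m\<in>elementary_cube n. \<exists>x\<in>L m. F x \<noteq> \<phi> m x"
      "\<And>n i j. i \<noteq> j \<Longrightarrow> \<exists>F. linear_form F \<and>
        (\<forall>m\<in>{n, n + unit_shift i, n + unit_shift j, n + unit_shift i + unit_shift j}. \<forall>x\<in>L m. F x = \<phi> m x)"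
  defines "Lhat \<equiv> \<lambda>n. (\<lambda>v. v + \<phi> n v *s c) ` L n"
  shows "line_complex_in UNIV Lhat" "general_position_CP4 Lhat" "fundamental_CP4 Lhat"
    "generic_centre (vec.span {c}) Lhat" "\<And>n. central_projection (vec.span {c}) H (Lhat n) = L n"
proof -
  define \<pi> where "\<pi> x = x - \<kappa> x *s c" for x
  have \<pi>: "\<pi> (v + a *s c) = v" if "v \<in> H" for v a
    using that \<kappa> by (simp add: \<pi>_def linear_form_add linear_form_scale)
  have \<kappa>_lift: "\<kappa> (v + a *s c) = a" if "v \<in> H" for v a
    using that \<kappa> by (simp add: linear_form_add linear_form_scale)
  have LH: "v \<in> H" if "v \<in> L n" for v n
    using line_complex_line(3)[OF L(1)] that by blast
  have sub_H: "vec.subspace H" "vec.dim H = 4"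
    using H by (auto simp: proj_subspace_def)
  have lift_image: "vec.subspace ((\<lambda>v. v + F v *s c) ` K)" "vec.dim ((\<lambda>v. v + F v *s c) ` K) = vec.dim K"
    if "linear_form F" "vec.subspace K" "K \<subseteq> H" for F :: "complex^5 \<Rightarrow> complex" and K
  proof -
    note lin = linear_add_form(1)[OF that(1), of c]
    show "vec.subspace ((\<lambda>v. v + F v *s c) ` K)"
      by (rule vec.linear_subspace_image[OF lin that(2)])
    have "inj_on (\<lambda>v. v + F v *s c) K"
      using \<pi> that(3) by (intro inj_on_inverseI[where g = \<pi>]) auto
    then show "vec.dim ((\<lambda>v. v + F v *s c) ` K) = vec.dim K"
      using vec.dim_image_eq[OF lin, of K] that(2) by (simp add: vec.span_eq_iff[THEN iffD2])
  qed
  have Lhat_sub: "vec.subspace (Lhat n)" "vec.dim (Lhat n) = 2" for n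
    using lift_image[OF \<phi>(1) line_complex_line(1)[OF L(1)] line_complex_line(3)[OF L(1)]]
      line_complex_line(2)[OF L(1)] by (simp_all add: Lhat_def)
  then show line: "line_complex_in UNIV Lhat"
    by (simp add: line_complex_in_def proj_subspace_def)
  have image: "\<pi> ` Lhat n = L n" for n
    unfolding Lhat_def image_image using \<pi> LH by (simp cong: image_cong_simp)
  then show "central_projection (vec.span {c}) H (Lhat n) = L n" for n
    using central_projection_image[OF \<kappa> Lhat_sub(1)] by (simp add: \<pi>_def[abs_def])
  have Lhat_mem: "\<pi> x \<in> L n \<and> x = \<pi> x + \<phi> n (\<pi> x) *s c" if "x \<in> Lhat n" for x n
    using that \<pi> LH by (auto simp: Lhat_def)
  have Lhat_neighbour: "Lhat n \<noteq> Lhat (n + unit_shift i)" for n i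
    using general_position_neighbours[OF L(2), of n i] image[of n] image[of "n + unit_shift i"] by auto
  have "proj_point (meet_point Lhat i n)" for i n
  proof -
    obtain u where u: "u \<noteq> 0" "meet_point L i n = vec.span {u}"
      using proj_point_obtain[OF point] .
    then have mem: "u \<in> meet_point L i n" by (simp add: vec.span_base)
    then have "u \<in> L n" "u \<in> L (n + unit_shift i)" by (auto simp: meet_point_def)
    moreover have "u + \<phi> n u *s c \<noteq> 0"
    proof
      assume "u + \<phi> n u *s c = 0"
      then have "\<pi> 0 = u" using \<pi>[of u "\<phi> n u"] LH[OF \<open>u \<in> L n\<close>] by simp
      with u(1) \<kappa>(1) show False by (simp add: \<pi>_def linear_form_zero)
    qed
    moreover have "\<phi> n u = \<phi> (n + unit_shift i) u"
      by (rule \<phi>(2)[OF mem])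
    ultimately have "u + \<phi> n u *s c \<in> Lhat n" "u + \<phi> n u *s c \<in> Lhat (n + unit_shift i)"
        "u + \<phi> n u *s c \<noteq> 0"
      by (simp_all add: Lhat_def image_eqI[of _ _ u])
    then show ?thesis
      by (rule meet_point_proj_point[OF line Lhat_neighbour])
  qed
  then show "fundamental_CP4 Lhat"
    by (simp add: fundamental_CP4_def neighbours_intersect_def)
  have face: "\<exists>F. linear_form F \<and> face_span Lhat i j n = (\<lambda>v. v + F v *s c) ` H \<and>
      (\<forall>m\<in>{n, n + unit_shift i, n + unit_shift j, n + unit_shift i + unit_shift j}. \<forall>x\<in>L m. F x = \<phi> m x)"
    if ij: "i \<noteq> j" for i j n
  proof -
    let ?V = "{n, n + unit_shift i, n + unit_shift j, n + unit_shift i + unit_shift j}"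
    obtain F where F: "linear_form F" "\<And>m x. m \<in> ?V \<Longrightarrow> x \<in> L m \<Longrightarrow> F x = \<phi> m x"
      using \<phi>(4)[OF ij] by blast
    have lifted: "Lhat m = (\<lambda>v. v + F v *s c) ` L m" if "m \<in> ?V" for m
      unfolding Lhat_def using F(2)[OF that] by (intro image_cong) auto
    have dim_face: "vec.dim (face_span L i j n) = 4"
    proof -
      have "proj_subspace 3 (face_span L i j n)"
        by (rule general_position_face[OF L(2) ij])
      then show ?thesis by (simp add: proj_subspace_def)
    qed
    have "face_span L i j n = H"
    proof (rule vec.subspace_dim_equal)
      show "face_span L i j n \<subseteq> H"
        unfolding face_span_def using LH sub_H by (intro vec.span_minimal) auto
    qed (use dim_face sub_H in \<open>auto simp: face_span_def\<close>)
    then have "(\<lambda>v. v + F v *s c) ` H = vec.span ((\<lambda>v. v + F v *s c) `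
        (L n \<union> L (n + unit_shift i) \<union> L (n + unit_shift j) \<union> L (n + unit_shift i + unit_shift j)))"
      unfolding face_span_def using vec.linear_span_image[OF linear_add_form(1)[OF F(1), of c]] by metis
    also have "\<dots> = face_span Lhat i j n"
      unfolding face_span_def image_Un using lifted by simp
    finally show ?thesis using F by blast
  qed
  have c_notin: "c \<notin> (\<lambda>v. v + F v *s c) ` H" if "linear_form F" for F :: "complex^5 \<Rightarrow> complex"
  proof
    assume "c \<in> (\<lambda>v. v + F v *s c) ` H"
    then obtain v where v: "v \<in> H" "c = v + F v *s c" by auto
    then have "\<pi> c = v" using \<pi> by metis
    moreover have "\<pi> c = 0" using \<kappa>(2) by (simp add: \<pi>_def)
    ultimately have "v = 0" by simp
    with v that have "c = 0" by (simp add: linear_form_zero)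
    with \<kappa>(1,2) show False by (simp add: linear_form_zero)
  qed
  have c_span: "c \<notin> vec.span (Lhat n \<union> Lhat (n + unit_shift i))" for n i
  proof -
    obtain j where "i \<noteq> j"
      using exhaust_3[of i] by (metis one_neq_zero)
    then obtain F where F: "linear_form F" "face_span Lhat i j n = (\<lambda>v. v + F v *s c) ` H"
      using face by metis
    have "vec.span (Lhat n \<union> Lhat (n + unit_shift i)) \<subseteq> face_span Lhat i j n"
      unfolding face_span_def by (intro vec.span_mono) auto
    with F c_notin[OF F(1)] show ?thesis by auto
  qed
  show "generic_centre (vec.span {c}) Lhat"
  proof -
    have "c \<in> vec.span {c}" by (simp add: vec.span_base)
    moreover have "Lhat n \<subseteq> vec.span (Lhat n \<union> Lhat (n + unit_shift i))" for n i
      by (auto intro: vec.span_base)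
    ultimately show ?thesis
      unfolding generic_centre_def using c_span by blast
  qed
  have distinct_points: "P \<noteq> Q"
    if prem: "s \<in> {-1, 1}" "t \<in> {-1, 1}" "i \<noteq> j" "proj_point P" "P \<subseteq> Lhat n \<inter> Lhat (n + axis i s)"
      "Q \<subseteq> Lhat n \<inter> Lhat (n + axis j t)" for n i j s t P Q
  proof
    assume "P = Q"
    obtain u where u: "u \<noteq> 0" "P = vec.span {u}"
      using proj_point_obtain[OF prem(4)] .
    have "u \<in> P" using u by (simp add: vec.span_base)
    with prem(5,6) \<open>P = Q\<close> have mem: "u \<in> Lhat n" "u \<in> Lhat (n + axis i s)" "u \<in> Lhat (n + axis j t)"
      by auto
    have nz: "\<pi> u \<noteq> 0"
      using Lhat_mem[OF mem(1)] u(1) \<phi>(1) by (auto simp: linear_form_zero)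
    have "vec.span {\<pi> u} \<subseteq> L n \<inter> L (n + axis i s)" "vec.span {\<pi> u} \<subseteq> L n \<inter> L (n + axis j t)"
      using mem Lhat_mem
      by (intro vec.span_minimal vec.subspace_inter line_complex_line[OF L(1)]; simp)+
    with general_position_points[OF L(2) prem(3,1,2)] proj_point_span[OF nz] show False
      by blast
  qed
  have face_dim: "proj_subspace 3 (face_span Lhat i j n)" if ij: "i \<noteq> j" for n i j
  proof -
    obtain F where F: "linear_form F" "face_span Lhat i j n = (\<lambda>v. v + F v *s c) ` H"
      using face[OF ij] by metis
    show ?thesis
      unfolding proj_subspace_def F(2) lift_image(2)[OF F(1) sub_H(1) order_refl] sub_H(2)
      by (rule conjI[OF lift_image(1)[OF F(1) sub_H(1) order_refl]]) simp
  qed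
  have opposite: "face_span Lhat j k n \<noteq> face_span Lhat j k (n + unit_shift i)"
    if ijk: "i \<noteq> j" "i \<noteq> k" "j \<noteq> k" for n i j k
  proof
    assume eq: "face_span Lhat j k n = face_span Lhat j k (n + unit_shift i)"
    obtain F where F: "linear_form F" "face_span Lhat j k n = (\<lambda>v. v + F v *s c) ` H"
      using face[OF ijk(3)] by metis
    have agree: "F x = \<phi> m x" if "Lhat m \<subseteq> face_span Lhat j k n" "x \<in> L m" for m x
    proof -
      have "x + \<phi> m x *s c \<in> (\<lambda>v. v + F v *s c) ` H"
        using that F(2) by (auto simp: Lhat_def)
      then obtain v where v: "v \<in> H" "x + \<phi> m x *s c = v + F v *s c" by auto
      have "x = v"
        using \<pi>[OF v(1), of "F v"] \<pi>[OF LH[OF that(2)], of "\<phi> m x"] v(2) by simp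
      have "F v = \<kappa> (v + F v *s c)"
        by (rule \<kappa>_lift[OF v(1), symmetric])
      also have "\<dots> = \<kappa> (x + \<phi> m x *s c)"
        by (simp only: v(2))
      also have "\<dots> = \<phi> m x"
        by (rule \<kappa>_lift[OF LH[OF that(2)]])
      finally show ?thesis
        by (simp only: \<open>x = v\<close>)
    qed
    obtain m x where "m \<in> elementary_cube n" "x \<in> L m" "F x \<noteq> \<phi> m x"
      using \<phi>(3)[OF F(1)] by blast
    moreover have "Lhat m \<subseteq> face_span Lhat j k n"
      using elementary_cube_faces[OF ijk \<open>m \<in> elementary_cube n\<close>]
        face_span_contains[where L = Lhat and n = n and i = j and j = k]
        face_span_contains[where L = Lhat and n = "n + unit_shift i" and i = j and j = k] eq
      by auto
    ultimately show False using agree by blast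
  qed
  show "general_position_CP4 Lhat"
    unfolding general_position_CP4_def general_position_def
  proof (intro conjI allI ballI impI)
    show "face_span Lhat j k n \<noteq> face_span Lhat j k (n + unit_shift i)"
      if "i \<noteq> j \<and> i \<noteq> k \<and> j \<noteq> k" for n i j k
      using that by (intro opposite) auto
  qed (fact Lhat_neighbour | rule distinct_points face_dim; assumption)+
qed

theorem theorem4p6:
  fixes H :: "(complex^5) set"
    and L :: "int^3 \<Rightarrow> (complex^5) set"
  assumes "proj_subspace 3 H"
    and "line_complex_in H L"
    and "general_position L"
  shows "fundamental_CP3 L \<longleftrightarrow>
    (\<exists>C Lhat. proj_point C \<and> \<not> C \<subseteq> H \<and>
       line_complex_in UNIV Lhat \<and> general_position_CP4 Lhat \<and> fundamental_CP4 Lhat \<and>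
       generic_centre C Lhat \<and>
       (\<forall>n. central_projection C H (Lhat n) = L n))"
proof
  have H: "vec.subspace H" "vec.dim H + 1 = CARD(5)"
    using assms(1) by (auto simp: proj_subspace_def)
  {
    assume fund: "fundamental_CP3 L"
    have "H \<noteq> UNIV"
      using H(2) by (auto simp: card_cart_basis)
    then obtain c where c: "c \<notin> H" by blast
    obtain \<kappa> where \<kappa>: "linear_form \<kappa>" "\<kappa> c = 1" "\<And>x. \<kappa> x = 0 \<longleftrightarrow> x \<in> H"
      using hyperplane_form[OF H c] by blast
    have point: "proj_point (meet_point L i n)" for i n
      using fund by (simp add: fundamental_CP3_def neighbours_intersect_def)
    have C: "proj_point (vec.span {c})" "\<not> vec.span {c} \<subseteq> H"
      using c H(1) vec.subspace_0 vec.span_base[of c "{c}"] by (auto intro!: proj_point_span)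
    show "\<exists>C Lhat. proj_point C \<and> \<not> C \<subseteq> H \<and>
       line_complex_in UNIV Lhat \<and> general_position_CP4 Lhat \<and> fundamental_CP4 Lhat \<and>
       generic_centre C Lhat \<and> (\<forall>n. central_projection C H (Lhat n) = L n)"
    proof (rule fundamental_compatible_forms[OF assms fund])
      fix \<phi> :: "int^3 \<Rightarrow> complex^5 \<Rightarrow> complex"
      assume \<phi>: "\<And>n. linear_form (\<phi> n)"
        "\<And>n i x. x \<in> meet_point L i n \<Longrightarrow> \<phi> n x = \<phi> (n + unit_shift i) x"
        "\<And>n F. linear_form F \<Longrightarrow> \<exists>m\<in>elementary_cube n. \<exists>x\<in>L m. F x \<noteq> \<phi> m x"
        "\<And>n i j. i \<noteq> j \<Longrightarrow> \<exists>F. linear_form F \<and>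
          (\<forall>m\<in>{n, n + unit_shift i, n + unit_shift j, n + unit_shift i + unit_shift j}. \<forall>x\<in>L m. F x = \<phi> m x)"
      note lift = graph_lift_properties[where \<phi> = \<phi>, OF assms \<kappa> point \<phi>]
      show ?thesis
        by (intro exI[of _ "vec.span {c}"] exI[of _ "\<lambda>n. (\<lambda>v. v + \<phi> n v *s c) ` L n"] conjI allI C lift)
    qed
  next
    assume "\<exists>C Lhat. proj_point C \<and> \<not> C \<subseteq> H \<and>
       line_complex_in UNIV Lhat \<and> general_position_CP4 Lhat \<and> fundamental_CP4 Lhat \<and>
       generic_centre C Lhat \<and> (\<forall>n. central_projection C H (Lhat n) = L n)"
    then obtain C Lhat where C: "proj_point C" "\<not> C \<subseteq> H" and Lhat: "line_complex_in UNIV Lhat"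
      "general_position_CP4 Lhat" "fundamental_CP4 Lhat" "generic_centre C Lhat"
      "\<And>n. central_projection C H (Lhat n) = L n"
      by blast
    obtain c where c: "c \<noteq> 0" "C = vec.span {c}"
      using proj_point_obtain[OF C(1)] .
    have "c \<notin> H" using C(2) c(2) H(1) vec.span_minimal[of "{c}" H] by auto
    obtain \<kappa> where \<kappa>: "linear_form \<kappa>" "\<kappa> c = 1" "\<And>x. \<kappa> x = 0 \<longleftrightarrow> x \<in> H"
      using hyperplane_form[OF H \<open>c \<notin> H\<close>] by blast
    show "fundamental_CP3 L"
    proof (rule projection_fundamental[OF assms(2,3) Lhat(1-3) \<kappa>(1)])
      show "L n = (\<lambda>x. x - \<kappa> x *s c) ` Lhat n" for n
        using Lhat(5)[of n] central_projection_image[OF \<kappa> line_complex_line(1)[OF Lhat(1)]] c(2) by simp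
      show "c \<notin> Lhat n" for n
        using Lhat(4) c(2) vec.span_minimal[OF _ line_complex_line(1)[OF Lhat(1)], of "{c}" n]
        unfolding generic_centre_def by blast
    qed
  }
qed

end
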